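(* Let $n\geqslant 1$ be an integer, $\mathcal{M}$ a type $\mathrm{I}_n$ von Neumann algebra and $T$ an operator in $\mathcal{M}$. The following statements are equivalent: (1) $T$ has property $(J)$; (2) $T$ has a finite strongly irreducible decomposition.
   Context: A type $\mathrm{I}_n$ von Neumann algebra is one isomorphic to $\mathbb{M}_n(\mathcal{A})$ with $\mathcal{A}$ an abelian von Neumann algebra. $\{T\}'\cap\mathcal{M}$ is the set of elements of $\mathcal{M}$ commuting with $T$. An idempotent is an element $P$ with $P^2=P$; an abelian family of idempotents is a set of pairwise commuting idempotents. $T\in\mathcal{M}$ has property $(J)$ if there exists a bounded (in norm) family of idempotents in $\{T\}'\cap\mathcal{M}$ that is maximal (under inclusion) among all abelian families of idempotents in $\{T\}'\cap\mathcal{M}$. For $Q\in\mathcal{M}$, $C_Q$ is its central support: the minimal central projection of $\mathcal{M}$ with $C_QQ=Q$. For idempotents $P,Q$ write $Q\preccurlyeq P$ if $Q=PQ=QP$. An idempotent $P\in\{T\}'\cap\mathcal{M}$ is centrally minimal if every idempotent $Q\in\{T\}'\cap\mathcal{M}$ with $Q\preccurlyeq P$ is of the form $Q=PC_Q$. A finite strongly irreducible decomposition of $T$ is a finite family $\{P_j\}_{j=1}^m$ of nonzero idempotents in $\{T\}'\cap\mathcal{M}$ with $\sum_{j=1}^mP_j=I_{\mathcal{M}}$, $P_jP_k=0$ for $j\ne k$, and each $P_j$ centrally minimal in $\{T\}'\cap\mathcal{M}$. *)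

theory Defs
  imports "HOL-Analysis.Analysis"
begin

section \<open>Complex Hilbert spaces\<close>

text \<open>
  The class \<open>banach\<close> supplies addition, real scaling, norm and completeness; the axioms below
  tie the complex scaling to the real one and the norm to the inner product, which is
  linear in its first argument.
\<close>

class complex_hilbert_space = banach +
  fixes scaleC :: "complex \<Rightarrow> 'a \<Rightarrow> 'a" (infixr \<open>*\<^sub>C\<close> 75)
    and cinner :: "'a \<Rightarrow> 'a \<Rightarrow> complex"
  assumes scaleR_eq_scaleC: "r *\<^sub>R x = complex_of_real r *\<^sub>C x"
    and scaleC_add_right: "a *\<^sub>C (x + y) = a *\<^sub>C x + a *\<^sub>C y"
    and scaleC_add_left: "(a + b) *\<^sub>C x = a *\<^sub>C x + b *\<^sub>C x"
    and scaleC_scaleC: "a *\<^sub>C (b *\<^sub>C x) = (a * b) *\<^sub>C x"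
    and cinner_commute: "cinner x y = cnj (cinner y x)"
    and cinner_add_left: "cinner (x + y) z = cinner x z + cinner y z"
    and cinner_scaleC_left: "cinner (a *\<^sub>C x) y = a * cinner x y"
    and cinner_ge_zero: "0 \<le> Re (cinner x x)"
    and cinner_eq_zero_iff: "cinner x x = 0 \<longleftrightarrow> x = 0"
    and norm_eq_sqrt_cinner: "norm x = sqrt (Re (cinner x x))"

lemma norm_scaleC: "norm (a *\<^sub>C x) = cmod a * norm (x :: 'a::complex_hilbert_space)"
proof -
  have "cinner x (a *\<^sub>C x) = cnj a * cinner x x"
    by (metis cinner_commute cinner_scaleC_left complex_cnj_cnj complex_cnj_mult)
  then have "cinner (a *\<^sub>C x) (a *\<^sub>C x) = a * cnj a * cinner x x"
    by (simp add: cinner_scaleC_left)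
  also have "\<dots> = complex_of_real ((cmod a)\<^sup>2) * cinner x x"
    by (simp only: complex_norm_square)
  finally show ?thesis
    by (simp add: norm_eq_sqrt_cinner real_sqrt_mult)
qed

section \<open>Bounded operators\<close>

text \<open>
  Operators are elements of the library type of bounded real-linear maps, with its operator
  norm and composition; \<open>bounded_ops\<close> singles out the complex-linear ones.
\<close>

definition bounded_ops :: "('h::complex_hilbert_space \<Rightarrow>\<^sub>L 'h) set" where
  "bounded_ops = {F. \<forall>c x. blinfun_apply F (c *\<^sub>C x) = c *\<^sub>C blinfun_apply F x}"

definition scaleC_op :: "complex \<Rightarrow> ('h::complex_hilbert_space \<Rightarrow>\<^sub>L 'h) \<Rightarrow> ('h \<Rightarrow>\<^sub>L 'h)" where
  "scaleC_op c F = Blinfun (\<lambda>x. c *\<^sub>C F x)"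

lemma scaleC_op_apply: "blinfun_apply (scaleC_op c F) x = c *\<^sub>C F x"
proof -
  have "bounded_linear (\<lambda>x. c *\<^sub>C F x)"
  proof (rule bounded_linear_intro)
    show "c *\<^sub>C F (x + y) = c *\<^sub>C F x + c *\<^sub>C F y" for x y
      by (simp add: blinfun.add_right scaleC_add_right)
    show "c *\<^sub>C F (r *\<^sub>R x) = r *\<^sub>R (c *\<^sub>C F x)" for r x
      by (simp only: blinfun.scaleR_right) (simp add: scaleR_eq_scaleC scaleC_scaleC mult.commute)
    show "norm (c *\<^sub>C F x) \<le> norm x * (norm F * cmod c)" for x
      using mult_left_mono[OF norm_blinfun[of F x] norm_ge_zero[of c]]
      by (simp add: norm_scaleC mult_ac)
  qed
  then show ?thesis
    by (simp add: scaleC_op_def bounded_linear_Blinfun_apply)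
qed

text \<open>For a complex-linear \<open>F\<close> the adjoint exists by the Riesz representation theorem.\<close>

definition adj :: "('h::complex_hilbert_space \<Rightarrow>\<^sub>L 'h) \<Rightarrow> ('h \<Rightarrow>\<^sub>L 'h)" where
  "adj F = (THE G. \<forall>x y. cinner (blinfun_apply F x) y = cinner x (blinfun_apply G y))"

definition commutant :: "('h::complex_hilbert_space \<Rightarrow>\<^sub>L 'h) set \<Rightarrow> ('h \<Rightarrow>\<^sub>L 'h) set" where
  "commutant S = {F \<in> bounded_ops. \<forall>G\<in>S. F o\<^sub>L G = G o\<^sub>L F}"

section \<open>Von Neumann algebras\<close>

text \<open>
  A commutant is automatically a unital weakly closed algebra, so a self-adjoint set equal to
  its double commutant is a von Neumann algebra with unit \<open>id_blinfun\<close>.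
\<close>

definition von_neumann_algebra :: "('h::complex_hilbert_space \<Rightarrow>\<^sub>L 'h) set \<Rightarrow> bool" where
  "von_neumann_algebra M \<longleftrightarrow>
     M \<subseteq> bounded_ops \<and> (\<forall>F\<in>M. adj F \<in> M) \<and> commutant (commutant M) = M"

definition pairwise_commuting :: "('h::complex_hilbert_space \<Rightarrow>\<^sub>L 'h) set \<Rightarrow> bool" where
  "pairwise_commuting S \<longleftrightarrow> (\<forall>F\<in>S. \<forall>G\<in>S. F o\<^sub>L G = G o\<^sub>L F)"

text \<open>
  Matrices of size \<open>n\<close> are functions of the two indices, with value zero outside the range
  \<open>{..<n} \<times> {..<n}\<close> so that equal matrices are equal functions.
\<close>

definition matrices ::
  "nat \<Rightarrow> ('k::complex_hilbert_space \<Rightarrow>\<^sub>L 'k) set \<Rightarrow> (nat \<Rightarrow> nat \<Rightarrow> ('k \<Rightarrow>\<^sub>L 'k)) set" where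
  "matrices n A = {X. \<forall>i j. if i < n \<and> j < n then X i j \<in> A else X i j = 0}"

definition star_iso_matrices ::
  "nat \<Rightarrow> ('h::complex_hilbert_space \<Rightarrow>\<^sub>L 'h) set \<Rightarrow> ('k::complex_hilbert_space \<Rightarrow>\<^sub>L 'k) set
    \<Rightarrow> (('h \<Rightarrow>\<^sub>L 'h) \<Rightarrow> nat \<Rightarrow> nat \<Rightarrow> ('k \<Rightarrow>\<^sub>L 'k)) \<Rightarrow> bool" where
  "star_iso_matrices n M A \<phi> \<longleftrightarrow>
     bij_betw \<phi> M (matrices n A) \<and>
     (\<forall>F\<in>M. \<forall>G\<in>M. \<phi> (F + G) = (\<lambda>i j. \<phi> F i j + \<phi> G i j)) \<and>
     (\<forall>c. \<forall>F\<in>M. \<phi> (scaleC_op c F) = (\<lambda>i j. scaleC_op c (\<phi> F i j))) \<and>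
     (\<forall>F\<in>M. \<forall>G\<in>M. \<phi> (F o\<^sub>L G) = (\<lambda>i j. \<Sum>k<n. \<phi> F i k o\<^sub>L \<phi> G k j)) \<and>
     (\<forall>F\<in>M. \<phi> (adj F) = (\<lambda>i j. adj (\<phi> F j i)))"

text \<open>
  The abelian algebra may act on a different Hilbert space. HOL cannot quantify existentially
  over that space, so the algebra is an argument; in a hypothesis, a free variable for it
  (and for its type) amounts to the existential quantification.
\<close>

definition type_I_via ::
  "nat \<Rightarrow> ('k::complex_hilbert_space \<Rightarrow>\<^sub>L 'k) set \<Rightarrow> ('h::complex_hilbert_space \<Rightarrow>\<^sub>L 'h) set \<Rightarrow> bool"
  where
  "type_I_via n A M \<longleftrightarrow>
     von_neumann_algebra M \<and> von_neumann_algebra A \<and> pairwise_commuting A \<and>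
     (\<exists>\<phi>. star_iso_matrices n M A \<phi>)"

section \<open>Idempotents and central supports\<close>

definition idempotents :: "('h::complex_hilbert_space \<Rightarrow>\<^sub>L 'h) set \<Rightarrow> ('h \<Rightarrow>\<^sub>L 'h) set" where
  "idempotents S = {P \<in> S. P o\<^sub>L P = P}"

definition idem_le ::
  "('h::complex_hilbert_space \<Rightarrow>\<^sub>L 'h) \<Rightarrow> ('h \<Rightarrow>\<^sub>L 'h) \<Rightarrow> bool" (infix \<open>\<preceq>\<close> 50) where
  "Q \<preceq> P \<longleftrightarrow> Q = P o\<^sub>L Q \<and> Q = Q o\<^sub>L P"

definition central_projections ::
  "('h::complex_hilbert_space \<Rightarrow>\<^sub>L 'h) set \<Rightarrow> ('h \<Rightarrow>\<^sub>L 'h) set" where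
  "central_projections M = {C \<in> M \<inter> commutant M. C o\<^sub>L C = C \<and> adj C = C}"

text \<open>On projections, \<open>\<preceq>\<close> is the usual order.\<close>

definition central_support ::
  "('h::complex_hilbert_space \<Rightarrow>\<^sub>L 'h) set \<Rightarrow> ('h \<Rightarrow>\<^sub>L 'h) \<Rightarrow> ('h \<Rightarrow>\<^sub>L 'h)" where
  "central_support M Q =
     (THE C. C \<in> central_projections M \<and> C o\<^sub>L Q = Q \<and>
        (\<forall>D \<in> central_projections M. D o\<^sub>L Q = Q \<longrightarrow> C \<preceq> D))"

section \<open>Property (J) and strongly irreducible decompositions\<close>

definition abelian_idempotent_family ::
  "('h::complex_hilbert_space \<Rightarrow>\<^sub>L 'h) set \<Rightarrow> ('h \<Rightarrow>\<^sub>L 'h) \<Rightarrow> ('h \<Rightarrow>\<^sub>L 'h) set \<Rightarrow> bool" where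
  "abelian_idempotent_family M T \<P> \<longleftrightarrow>
     \<P> \<subseteq> idempotents (commutant {T} \<inter> M) \<and> pairwise_commuting \<P>"

definition property_J ::
  "('h::complex_hilbert_space \<Rightarrow>\<^sub>L 'h) set \<Rightarrow> ('h \<Rightarrow>\<^sub>L 'h) \<Rightarrow> bool" where
  "property_J M T \<longleftrightarrow>
     (\<exists>\<P>. abelian_idempotent_family M T \<P> \<and> bounded \<P> \<and>
        (\<forall>\<Q>. abelian_idempotent_family M T \<Q> \<and> \<P> \<subseteq> \<Q> \<longrightarrow> \<Q> = \<P>))"

definition centrally_minimal ::
  "('h::complex_hilbert_space \<Rightarrow>\<^sub>L 'h) set \<Rightarrow> ('h \<Rightarrow>\<^sub>L 'h) \<Rightarrow> ('h \<Rightarrow>\<^sub>L 'h) \<Rightarrow> bool" where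
  "centrally_minimal M T P \<longleftrightarrow>
     P \<in> idempotents (commutant {T} \<inter> M) \<and>
     (\<forall>Q \<in> idempotents (commutant {T} \<inter> M). Q \<preceq> P \<longrightarrow> Q = P o\<^sub>L central_support M Q)"

text \<open>
  The empty family \<open>m = 0\<close> is a decomposition only if the Hilbert space is zero, where there is
  no nonzero idempotent.
\<close>

definition has_finite_SI_decomposition ::
  "('h::complex_hilbert_space \<Rightarrow>\<^sub>L 'h) set \<Rightarrow> ('h \<Rightarrow>\<^sub>L 'h) \<Rightarrow> bool" where
  "has_finite_SI_decomposition M T \<longleftrightarrow>
     (\<exists>(m::nat) P.
        (\<forall>j\<in>{1..m}. P j \<in> idempotents (commutant {T} \<inter> M) \<and> P j \<noteq> 0 \<and> centrally_minimal M T (P j)) \<and>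
        (\<Sum>j=1..m. P j) = id_blinfun \<and>
        (\<forall>j\<in>{1..m}. \<forall>k\<in>{1..m}. j \<noteq> k \<longrightarrow> P j o\<^sub>L P k = 0))"

end

theory Submission
  imports Defs
begin

text \<open>
  The implication from decompositions to \<open>(J)\<close> is a computation. If \<open>P 1, \<dots>, P m\<close> is a
  decomposition, then the operators \<open>\<Sum>j. P j o\<^sub>L C j\<close>, with central projections \<open>C j\<close>, form a
  bounded abelian family. An idempotent \<open>Q\<close> of \<open>{T}' \<inter> M\<close> that commutes with this family cuts each
  \<open>P j\<close> to an idempotent below it, which by minimality is \<open>P j\<close> times a central projection; so \<open>Q\<close> is
  already of this form, and the family is maximal.

  For the converse let \<open>\<P>\<close> be a bounded maximal abelian family. An element that is minimal among
  the members of \<open>\<P>\<close> is minimal among all idempotents of \<open>{T}' \<inter> M\<close>, since an idempotent below it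
  commutes with \<open>\<P>\<close> and so belongs to \<open>\<P>\<close> (\<open>minimal_in_family_imp_centrally_minimal\<close>). So it suffices
  to split the identity inside \<open>\<P>\<close>. Call \<open>E\<close> full on a central projection \<open>C\<close> if \<open>C\<close> is its central
  support. Type \<open>I\<^sub>n\<close> enters in one place only: there are never more than \<open>n\<close> orthogonal idempotents
  that are full on the same nonzero \<open>C\<close> (\<open>type_I_finiteness\<close>). Given \<open>C \<noteq> 0\<close>, choose a nonzero
  central \<open>D\<close> below \<open>C\<close> and in \<open>\<P>\<close> orthogonal idempotents full on \<open>D\<close>, as many as are possible below
  \<open>C\<close>. A nonzero remainder of \<open>D\<close>, or a splitting of a member into two parts whose central supports
  overlap, would give a longer system over a smaller projection; so these idempotents
  sum to \<open>D\<close> and are minimal (\<open>full_system_maximal_splits\<close>). By Zorn's lemma a maximal orthogonal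
  family of such \<open>D\<close> has supremum the identity (\<open>central_exhaustion\<close>). The \<open>i\<close>-th idempotents over the
  various \<open>D\<close> are uniformly bounded because \<open>\<P>\<close> is, and they live on mutually orthogonal summands
  of the Hilbert space; hence they add up strongly to one operator of \<open>M\<close> (\<open>central_patching\<close>). The
  \<open>n\<close> operators obtained in this way, without the zero ones, are the decomposition.

  The finiteness replaces the pointwise dimension count over the spectrum of the centre by linear
  algebra over the reduced commutative ring \<open>A\<close>. From \<open>n + 1\<close> orthogonal idempotents \<open>E i\<close> full
  on \<open>C\<close> one builds a nonzero \<open>W\<close> that factors as \<open>L i o\<^sub>L E i o\<^sub>L R i\<close> for every \<open>i\<close> (\<open>full_on_chain\<close>).
  The \<open>q\<close>-th columns of the matrices of \<open>E i o\<^sub>L R i\<close> are \<open>n + 1\<close> vectors in \<open>A\<^sup>n\<close>, so they have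
  a linear relation that does not vanish on a prescribed entry of \<open>W\<close> (\<open>linear_dependence\<close>). But
  multiplication by \<open>L i o\<^sub>L E i\<close> isolates the \<open>i\<close>-th term of the relation and shows that
  its coefficient kills that entry.
\<close>

section \<open>Inner products, projections and adjoints\<close>

lemma cinner_add_right: "cinner x (y + z) = cinner x y + cinner x (z :: 'a::complex_hilbert_space)"
  by (metis cinner_add_left cinner_commute complex_cnj_add)

lemma cinner_scaleC_right: "cinner x (a *\<^sub>C y) = cnj a * cinner x (y :: 'a::complex_hilbert_space)"
  by (metis cinner_commute cinner_scaleC_left complex_cnj_mult)

lemma scaleC_minus_one: "(-1) *\<^sub>C x = - (x :: 'a::complex_hilbert_space)"
  using scaleR_eq_scaleC[of "-1" x] by simp

lemma scaleC_zero_right [simp]: "a *\<^sub>C (0 :: 'a::complex_hilbert_space) = 0"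
  using scaleC_add_right[of a 0 0] by simp

lemma cinner_zero_left [simp]: "cinner 0 (x :: 'a::complex_hilbert_space) = 0"
  using cinner_add_left[of 0 0 x] by simp

lemma cinner_zero_right [simp]: "cinner (x :: 'a::complex_hilbert_space) 0 = 0"
  using cinner_add_right[of x 0 0] by simp

lemma cinner_minus_left: "cinner (- x) y = - cinner x (y :: 'a::complex_hilbert_space)"
  using cinner_add_left[of "-x" x y] by (simp add: add_eq_0_iff)

lemma cinner_minus_right: "cinner x (- y) = - cinner x (y :: 'a::complex_hilbert_space)"
  using cinner_add_right[of x "-y" y] by (simp add: add_eq_0_iff)

lemma cinner_diff_left: "cinner (x - y) z = cinner x z - cinner y (z :: 'a::complex_hilbert_space)"
  using cinner_add_left[of x "-y" z] by (simp add: cinner_minus_left)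

lemma cinner_diff_right: "cinner x (y - z) = cinner x y - cinner x (z :: 'a::complex_hilbert_space)"
  using cinner_add_right[of x y "-z"] by (simp add: cinner_minus_right)

lemma cinner_sum_left:
  "cinner (\<Sum>i\<in>I. f i) y = (\<Sum>i\<in>I. cinner (f i) (y :: 'a::complex_hilbert_space))"
  by (induction I rule: infinite_finite_induct) (simp_all add: cinner_add_left)

lemma cinner_sum_right:
  "cinner y (\<Sum>i\<in>I. f i) = (\<Sum>i\<in>I. cinner y (f i :: 'a::complex_hilbert_space))"
  by (induction I rule: infinite_finite_induct) (simp_all add: cinner_add_right)

lemma cinner_self: "cinner x x = complex_of_real ((norm (x :: 'a::complex_hilbert_space))\<^sup>2)"
proof -
  have "Im (cinner x x) = 0"
    using arg_cong[OF cinner_commute[of x x], of Im] by simp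
  then show ?thesis
    by (simp add: complex_eq_iff norm_eq_sqrt_cinner cinner_ge_zero)
qed

lemma cinner_eqI:
  assumes "\<And>x. cinner x y = cinner x (z :: 'a::complex_hilbert_space)"
  shows "y = z"
  using assms[of "y - z"] cinner_eq_zero_iff[of "y - z"] by (simp add: cinner_diff_right)

lemma norm_diff_squared:
  "(norm (x - y))\<^sup>2 = (norm x)\<^sup>2 + (norm y)\<^sup>2 - 2 * Re (cinner x (y :: 'a::complex_hilbert_space))"
proof -
  have "Re (cinner y x) = Re (cinner x y)"
    using arg_cong[OF cinner_commute[of y x], of Re] by simp
  moreover have "complex_of_real ((norm (x - y))\<^sup>2)
      = complex_of_real ((norm x)\<^sup>2) + complex_of_real ((norm y)\<^sup>2) - cinner x y - cinner y x"
    by (simp only: cinner_self[symmetric]) (simp add: cinner_diff_left cinner_diff_right)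
  ultimately show ?thesis
    by (simp add: complex_eq_iff)
qed

lemma norm_orthogonal_diff:
  assumes "cinner x y = (0::complex)"
  shows "(norm (x - y))\<^sup>2 = (norm x)\<^sup>2 + (norm (y :: 'a::complex_hilbert_space))\<^sup>2"
  by (simp add: norm_diff_squared assms)

text \<open>
  Subtracting from \<open>z\<close> its component along \<open>y\<close> would shorten it.
\<close>

lemma norm_minimal_imp_orthogonal:
  fixes z y :: "'a::complex_hilbert_space"
  assumes "\<And>t. norm z \<le> norm (z - t *\<^sub>C y)"
  shows "cinner z y = 0"
proof (cases "y = 0")
  case False
  define t where "t = cinner z y / cinner y y"
  have ny: "cinner y y \<noteq> 0"
    using False cinner_eq_zero_iff by blast
  have "cinner (z - t *\<^sub>C y) (t *\<^sub>C y) = 0"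
    using ny by (simp add: cinner_diff_left cinner_scaleC_left cinner_scaleC_right t_def)
  then have "(norm (z - t *\<^sub>C y + t *\<^sub>C y))\<^sup>2 = (norm (z - t *\<^sub>C y))\<^sup>2 + (norm (t *\<^sub>C y))\<^sup>2"
    using norm_orthogonal_diff[of "z - t *\<^sub>C y" "- (t *\<^sub>C y)"] by (simp add: cinner_minus_right)
  moreover have "(norm z)\<^sup>2 \<le> (norm (z - t *\<^sub>C y))\<^sup>2"
    using assms[of t] by (simp add: power_mono)
  ultimately have "norm (t *\<^sub>C y) = 0"
    by simp
  then show ?thesis
    using False ny by (simp add: norm_scaleC t_def)
qed simp

lemma cinner_Cauchy_Schwarz: "cmod (cinner x y) \<le> norm x * norm (y :: 'a::complex_hilbert_space)"
proof (cases "y = 0")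
  case False
  define t where "t = cinner x y / cinner y y"
  have ny: "cinner y y \<noteq> 0"
    using False cinner_eq_zero_iff by blast
  have "cinner (x - t *\<^sub>C y) (t *\<^sub>C y) = 0"
    using ny by (simp add: cinner_diff_left cinner_scaleC_left cinner_scaleC_right t_def)
  then have "(norm x)\<^sup>2 = (norm (x - t *\<^sub>C y))\<^sup>2 + (norm (t *\<^sub>C y))\<^sup>2"
    using norm_orthogonal_diff[of "x - t *\<^sub>C y" "- (t *\<^sub>C y)"] by (simp add: cinner_minus_right)
  then have "norm (t *\<^sub>C y) \<le> norm x"
    by (simp add: power2_le_imp_le)
  moreover have "norm (t *\<^sub>C y) = cmod (cinner x y) / norm y"
    using False by (simp add: norm_scaleC t_def cinner_self norm_divide power2_eq_square norm_mult)
  ultimately show ?thesis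
    using False by (simp add: field_simps)
qed simp

definition closed_csubspace :: "'a::complex_hilbert_space set \<Rightarrow> bool" where
  "closed_csubspace K \<longleftrightarrow> closed K \<and> 0 \<in> K \<and> (\<forall>x\<in>K. \<forall>y\<in>K. x + y \<in> K) \<and> (\<forall>c. \<forall>x\<in>K. c *\<^sub>C x \<in> K)"

lemma closed_csubspace_minus:
  assumes "closed_csubspace K" "x \<in> K" shows "- x \<in> K"
  using assms by (metis closed_csubspace_def scaleC_minus_one)

lemma closed_csubspace_diff:
  assumes "closed_csubspace K" "x \<in> K" "y \<in> K" shows "x - y \<in> K"
  using assms closed_csubspace_minus[of K y] unfolding closed_csubspace_def
  by (metis diff_conv_add_uminus)

text \<open>
  A minimizing sequence for the distance to \<open>K\<close> is Cauchy by the parallelogram law; its limit is a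
  nearest point, and a nearest point has an orthogonal error.
\<close>

lemma orthogonal_projection_exists:
  fixes K :: "'a::complex_hilbert_space set"
  assumes K: "closed_csubspace K"
  shows "\<exists>k\<in>K. \<forall>y\<in>K. cinner (x - k) y = 0"
proof -
  define d where "d = infdist x K"
  have ne: "K \<noteq> {}"
    using K by (auto simp: closed_csubspace_def)
  have d0: "0 \<le> d"
    by (simp add: d_def infdist_nonneg)
  have dle: "d\<^sup>2 \<le> (norm (x - y))\<^sup>2" if "y \<in> K" for y
    using infdist_le[OF that, of x] d0 by (simp add: d_def dist_norm power_mono)
  have "\<exists>y\<in>K. (norm (x - y))\<^sup>2 < d\<^sup>2 + e" if e: "e > 0" for e
  proof -
    have "d < sqrt (d\<^sup>2 + e)"
      using d0 e by (simp add: real_less_rsqrt)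
    then obtain y where "y \<in> K" "dist x y < sqrt (d\<^sup>2 + e)"
      using ne infdist_notempty[of K x] cINF_less_iff[of K "dist x"] unfolding d_def
      by auto
    then have "(norm (x - y))\<^sup>2 < (sqrt (d\<^sup>2 + e))\<^sup>2"
      by (intro power_strict_mono) (auto simp: dist_norm)
    then show ?thesis
      using \<open>y \<in> K\<close> e by auto
  qed
  then have "\<forall>n. \<exists>y\<in>K. (norm (x - y))\<^sup>2 < d\<^sup>2 + 1 / real (Suc n)"
    by simp
  then obtain f where fK: "\<And>n. f n \<in> K" and fd: "\<And>n. (norm (x - f n))\<^sup>2 < d\<^sup>2 + 1 / real (Suc n)"
    by metis
  \<comment> \<open>The parallelogram law, applied to the midpoint of \<open>y\<close> and \<open>z\<close>, which lies in \<open>K\<close> and so has distance at least \<open>d\<close>.\<close>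
  have par: "(norm (y - z))\<^sup>2 \<le> 2 * (norm (x - y))\<^sup>2 + 2 * (norm (x - z))\<^sup>2 - 4 * d\<^sup>2"
    if "y \<in> K" "z \<in> K" for y z
  proof -
    define m where "m = (1/2) *\<^sub>C (y + z)"
    have "m \<in> K"
      using K that by (auto simp: closed_csubspace_def m_def)
    have two: "2 *\<^sub>R (x - m) = (x - y) + (x - z)"
    proof -
      have "2 *\<^sub>R m = y + z"
        by (simp add: m_def scaleR_eq_scaleC scaleC_scaleC) (metis scaleR_eq_scaleC scaleR_one of_real_1)
      moreover have "2 *\<^sub>R x = x + x"
        by (rule scaleR_2)
      ultimately show ?thesis
        by (simp add: algebra_simps)
    qed
    have "(norm ((x - y) + (x - z)))\<^sup>2 = 4 * (norm (x - m))\<^sup>2"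
      by (simp add: two[symmetric] power_mult_distrib)
    then have "4 * d\<^sup>2 \<le> (norm ((x - y) + (x - z)))\<^sup>2"
      using dle[OF \<open>m \<in> K\<close>] by simp
    moreover have "(norm ((x - y) + (x - z)))\<^sup>2
        = (norm (x - y))\<^sup>2 + (norm (x - z))\<^sup>2 + 2 * Re (cinner (x - y) (x - z))"
      using norm_diff_squared[of "x - y" "- (x - z)"]
      by (simp only: diff_minus_eq_add cinner_minus_right norm_minus_cancel uminus_complex.sel)
    moreover have "(norm (z - y))\<^sup>2
        = (norm (x - y))\<^sup>2 + (norm (x - z))\<^sup>2 - 2 * Re (cinner (x - y) (x - z))"
      using norm_diff_squared[of "x - y" "x - z"] by simp
    ultimately show ?thesis
      unfolding norm_minus_commute[of y z] by linarith
  qed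
  have "Cauchy f"
  proof (rule metric_CauchyI)
    fix e :: real
    assume "e > 0"
    then obtain N where N: "4 / real (Suc N) < e\<^sup>2"
      using reals_Archimedean[of "e\<^sup>2 / 4"] by (auto simp: field_simps)
    have "dist (f i) (f j) < e" if "i \<ge> N" "j \<ge> N" for i j
    proof -
      have "1 / real (Suc i) \<le> 1 / real (Suc N)" "1 / real (Suc j) \<le> 1 / real (Suc N)"
        using that by (auto simp: frac_le)
      moreover have "4 / real (Suc N) = 4 * (1 / real (Suc N))"
        by simp
      ultimately have "(norm (f i - f j))\<^sup>2 < e\<^sup>2"
        using par[OF fK fK, of i j] fd[of i] fd[of j] N by linarith
      then show ?thesis
        using \<open>e > 0\<close> by (simp add: dist_norm power2_less_imp_less)
    qed
    then show "\<exists>N. \<forall>i\<ge>N. \<forall>j\<ge>N. dist (f i) (f j) < e"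
      by blast
  qed
  then obtain k where k: "f \<longlonglongrightarrow> k"
    using Cauchy_convergent convergent_def by blast
  have kK: "k \<in> K"
    using K fK k closed_sequentially unfolding closed_csubspace_def by blast
  have "(norm (x - k))\<^sup>2 \<le> d\<^sup>2"
  proof (rule LIMSEQ_le)
    show "(\<lambda>n. (norm (x - f n))\<^sup>2) \<longlonglongrightarrow> (norm (x - k))\<^sup>2"
      by (intro tendsto_intros k)
    show "(\<lambda>n. d\<^sup>2 + 1 / real (Suc n)) \<longlonglongrightarrow> d\<^sup>2"
      using tendsto_add[OF tendsto_const[of "d\<^sup>2"] LIMSEQ_inverse_real_of_nat] by (simp add: inverse_eq_divide)
    show "\<exists>N. \<forall>n\<ge>N. (norm (x - f n))\<^sup>2 \<le> d\<^sup>2 + 1 / real (Suc n)"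
      using fd less_imp_le by blast
  qed
  then have min: "norm (x - k) \<le> norm (x - y)" if "y \<in> K" for y
    using dle[OF that] by (meson norm_ge_zero order_trans power2_le_imp_le)
  have "cinner (x - k) y = 0" if "y \<in> K" for y
  proof (rule norm_minimal_imp_orthogonal)
    fix t
    have "k + t *\<^sub>C y \<in> K"
      using K kK that by (auto simp: closed_csubspace_def)
    then show "norm (x - k) \<le> norm (x - k - t *\<^sub>C y)"
      using min[of "k + t *\<^sub>C y"] by (simp add: algebra_simps)
  qed
  then show ?thesis
    using kK by blast
qed

lemma orthogonal_projection:
  fixes K :: "'a::complex_hilbert_space set"
  assumes K: "closed_csubspace K"
  obtains p where "p \<in> bounded_ops" "\<And>x. blinfun_apply p x \<in> K" "\<And>x. x \<in> K \<Longrightarrow> blinfun_apply p x = x"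
    "\<And>x y. y \<in> K \<Longrightarrow> cinner (x - blinfun_apply p x) y = 0"
proof -
  obtain g where gK: "\<And>x. g x \<in> K" and go: "\<And>x y. y \<in> K \<Longrightarrow> cinner (x - g x) y = 0"
    using orthogonal_projection_exists[OF K] by metis
  have uniq: "g x = k" if "k \<in> K" and o: "\<And>y. y \<in> K \<Longrightarrow> cinner (x - k) y = 0" for x k
  proof -
    have "g x - k \<in> K"
      using closed_csubspace_diff[OF K] gK that by blast
    then have "cinner (g x - k) (g x - k) = 0"
      using go[of "g x - k" x] o[of "g x - k"] by (simp add: cinner_diff_left)
    then show ?thesis
      using cinner_eq_zero_iff[of "g x - k"] by simp
  qed
  have add: "g (x + y) = g x + g y" for x y
  proof (rule uniq)
    show "g x + g y \<in> K"
      using K gK by (auto simp: closed_csubspace_def)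
    show "cinner (x + y - (g x + g y)) z = 0" if "z \<in> K" for z
      using go[OF that, of x] go[OF that, of y] by (simp add: cinner_diff_left cinner_add_left)
  qed
  have scale: "g (c *\<^sub>C x) = c *\<^sub>C g x" for c x
  proof (rule uniq)
    show "c *\<^sub>C g x \<in> K"
      using K gK by (auto simp: closed_csubspace_def)
    show "cinner (c *\<^sub>C x - c *\<^sub>C g x) z = 0" if "z \<in> K" for z
      using go[OF that, of x] by (simp add: cinner_diff_left cinner_scaleC_left)
  qed
  have bnd: "norm (g x) \<le> norm x" for x
  proof -
    have "(norm (x - g x - (- g x)))\<^sup>2 = (norm (x - g x))\<^sup>2 + (norm (- g x))\<^sup>2"
      by (rule norm_orthogonal_diff) (simp add: cinner_minus_right go gK)
    then show ?thesis
      by (simp add: power2_le_imp_le)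
  qed
  have bl: "bounded_linear g"
  proof (rule bounded_linear_intro[where K = 1])
    show "g (r *\<^sub>R x) = r *\<^sub>R g x" for r x
      by (simp only: scaleR_eq_scaleC scale)
  qed (use add bnd in auto)
  have app: "blinfun_apply (Blinfun g) = g"
    using bl by (rule bounded_linear_Blinfun_apply)
  show thesis
  proof (rule that[of "Blinfun g"])
    show "Blinfun g \<in> bounded_ops"
      by (simp add: bounded_ops_def app scale)
    show "Blinfun g x = x" if "x \<in> K" for x
      using that by (simp add: app uniq)
  qed (simp_all add: app gK go)
qed

text \<open>
  The representing vector is a multiple of any nonzero vector \<open>z\<close> orthogonal to the kernel of \<open>f\<close>, because every
  \<open>x\<close> differs from a multiple of \<open>z\<close> by a kernel vector.
\<close>

lemma Riesz_representation:
  fixes f :: "'a::complex_hilbert_space \<Rightarrow> complex"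
  assumes add: "\<And>x y. f (x + y) = f x + f y"
    and scale: "\<And>c x. f (c *\<^sub>C x) = c * f x"
    and bnd: "\<And>x. cmod (f x) \<le> B * norm x"
  shows "\<exists>v. \<forall>x. f x = cinner x v"
proof (cases "\<forall>x. f x = 0")
  case True
  then show ?thesis
    by (intro exI[of _ 0]) simp
next
  case False
  then obtain x0 where x0: "f x0 \<noteq> 0"
    by blast
  have bl: "bounded_linear f"
  proof (rule bounded_linear_intro[where K = B])
    show "f (r *\<^sub>R x) = r *\<^sub>R f x" for r x
      by (simp only: scaleR_eq_scaleC scale) (simp add: scaleR_conv_of_real)
  qed (use add bnd in \<open>auto simp: mult.commute\<close>)
  have diff: "f (x - y) = f x - f y" for x y
    using bl by (simp add: bounded_linear.linear linear_diff)
  have "closed_csubspace {x. f x = 0}"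
    unfolding closed_csubspace_def
    using bl closed_Collect_eq[of f "\<lambda>_. 0"]
    by (auto simp: add scale linear_0 bounded_linear.linear
        intro: linear_continuous_on bounded_linear.continuous_on continuous_intros)
  then obtain k where k: "f k = 0" and ko: "\<And>y. f y = 0 \<Longrightarrow> cinner (x0 - k) y = 0"
    using orthogonal_projection_exists[of "{x. f x = 0}" x0] by blast
  define z where "z = x0 - k"
  have fz: "f z \<noteq> 0"
    using x0 k by (simp add: z_def diff)
  then have "z \<noteq> 0"
    using linear_0[OF bounded_linear.linear[OF bl]] by metis
  then have zz: "cinner z z \<noteq> 0"
    using cinner_eq_zero_iff by blast
  have "f x = cinner x (cnj (f z / cinner z z) *\<^sub>C z)" for x
  proof -
    have "f (x - (f x / f z) *\<^sub>C z) = 0"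
      using fz by (simp add: diff scale)
    then have "cinner z (x - (f x / f z) *\<^sub>C z) = 0"
      using ko by (simp add: z_def)
    then have "cinner (x - (f x / f z) *\<^sub>C z) z = 0"
      using cinner_commute[of "x - (f x / f z) *\<^sub>C z" z] by simp
    then show ?thesis
      using fz zz by (simp add: cinner_diff_left cinner_scaleC_left cinner_scaleC_right field_simps)
  qed
  then show ?thesis
    by blast
qed

lemma adj_eqI:
  fixes F :: "'h::complex_hilbert_space \<Rightarrow>\<^sub>L 'h"
  assumes "\<And>x y. cinner (blinfun_apply F x) y = cinner x (blinfun_apply G y)"
  shows "adj F = G"
  unfolding adj_def
proof (rule the_equality)
  show "H = G" if "\<forall>x y. cinner (blinfun_apply F x) y = cinner x (blinfun_apply H y)" for H
    using that assms by (metis blinfun_eqI cinner_eqI)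
qed (use assms in blast)

text \<open>
  This makes the definite description in the definition of the adjoint meaningful.
\<close>

lemma cinner_adj:
  fixes F :: "'h::complex_hilbert_space \<Rightarrow>\<^sub>L 'h"
  assumes F: "F \<in> bounded_ops"
  shows "cinner (blinfun_apply F x) y = cinner x (blinfun_apply (adj F) y)"
proof -
  have "\<exists>v. \<forall>x. cinner (blinfun_apply F x) y = cinner x v" for y
  proof (rule Riesz_representation)
    show "cmod (cinner (F x) y) \<le> (norm F * norm y) * norm x" for x
      using cinner_Cauchy_Schwarz[of "F x" y] mult_right_mono[OF norm_blinfun[of F x] norm_ge_zero[of y]]
      by (simp add: algebra_simps)
  qed (use F in \<open>auto simp: bounded_ops_def blinfun.add_right cinner_add_left cinner_scaleC_left\<close>)
  then obtain g where g: "\<And>x y. cinner (blinfun_apply F x) y = cinner x (g y)"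
    by metis
  have bl: "bounded_linear g"
  proof (rule bounded_linear_intro)
    show "g (x + y) = g x + g y" for x y
      by (rule cinner_eqI) (simp add: cinner_add_right flip: g)
    show "g (r *\<^sub>R x) = r *\<^sub>R g x" for r x
      by (rule cinner_eqI) (simp add: scaleR_eq_scaleC cinner_scaleC_right flip: g)
    show "norm (g y) \<le> norm y * norm F" for y
    proof (cases "g y = 0")
      case False
      have "complex_of_real ((norm (g y))\<^sup>2) = cinner (F (g y)) y"
        by (simp add: g cinner_self)
      then have "(norm (g y))\<^sup>2 = cmod (cinner (F (g y)) y)"
        by (metis abs_of_nonneg norm_of_real zero_le_power2)
      also have "\<dots> \<le> norm (F (g y)) * norm y"
        by (rule cinner_Cauchy_Schwarz)
      also have "\<dots> \<le> norm F * norm (g y) * norm y"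
        by (rule mult_right_mono[OF norm_blinfun]) simp
      finally show ?thesis
        using False by (simp add: power2_eq_square mult_ac)
    qed simp
  qed
  have app: "blinfun_apply (Blinfun g) = g"
    using bl by (rule bounded_linear_Blinfun_apply)
  have "adj F = Blinfun g"
    by (rule adj_eqI) (simp add: app g)
  then show ?thesis
    by (simp add: app g)
qed

lemma cinner_adj_left:
  fixes F :: "'h::complex_hilbert_space \<Rightarrow>\<^sub>L 'h"
  assumes F: "F \<in> bounded_ops"
  shows "cinner (blinfun_apply (adj F) x) y = cinner x (blinfun_apply F y)"
  by (metis F cinner_adj cinner_commute)

lemma adj_bounded_ops:
  fixes F :: "'h::complex_hilbert_space \<Rightarrow>\<^sub>L 'h"
  assumes F: "F \<in> bounded_ops"
  shows "adj F \<in> bounded_ops"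
proof -
  have "adj F (c *\<^sub>C x) = c *\<^sub>C adj F x" for c x
    by (rule cinner_eqI) (simp add: cinner_scaleC_right flip: cinner_adj[OF F])
  then show ?thesis
    by (simp add: bounded_ops_def)
qed

section \<open>Operators and commutants\<close>

lemmas compose_sum_left = bounded_bilinear.sum_left[OF bounded_bilinear_blinfun_compose]
lemmas compose_sum_right = bounded_bilinear.sum_right[OF bounded_bilinear_blinfun_compose]

lemmas compose_simps =
  bounded_bilinear.add_left[OF bounded_bilinear_blinfun_compose]
  bounded_bilinear.add_right[OF bounded_bilinear_blinfun_compose]
  bounded_bilinear.diff_left[OF bounded_bilinear_blinfun_compose]
  bounded_bilinear.diff_right[OF bounded_bilinear_blinfun_compose]
  bounded_bilinear.minus_left[OF bounded_bilinear_blinfun_compose]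
  bounded_bilinear.minus_right[OF bounded_bilinear_blinfun_compose]
  compose_sum_left compose_sum_right

lemma compose_assoc: "(F o\<^sub>L G) o\<^sub>L H = F o\<^sub>L (G o\<^sub>L H)"
  by (simp add: blinfun_eqI)

lemma compose_id [simp]: "F o\<^sub>L id_blinfun = F" "id_blinfun o\<^sub>L F = F"
  by (simp_all add: blinfun_eqI)

lemma commutant_iff:
  "F \<in> commutant S \<longleftrightarrow> F \<in> bounded_ops \<and> (\<forall>G\<in>S. F o\<^sub>L G = G o\<^sub>L F)"
  by (simp add: commutant_def)

lemma commutant_apply:
  assumes "F \<in> commutant S" "G \<in> S"
  shows "F (G x) = G (F x)"
  using assms by (metis blinfun_apply_blinfun_compose commutant_iff)

lemma bounded_opsD: "F \<in> bounded_ops \<Longrightarrow> F (c *\<^sub>C x) = c *\<^sub>C F x"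
  by (simp add: bounded_ops_def)

lemma scaleC_minus_right: "c *\<^sub>C (- x) = - (c *\<^sub>C (x :: 'a::complex_hilbert_space))"
  using scaleC_add_right[of c x "-x"] by (simp add: eq_neg_iff_add_eq_0 add.commute)

lemma commutant_zero: "0 \<in> commutant S"
  by (simp add: commutant_iff bounded_ops_def)

lemma commutant_id: "id_blinfun \<in> commutant S"
  by (simp add: commutant_iff bounded_ops_def)

lemma commutant_add: "F \<in> commutant S \<Longrightarrow> G \<in> commutant S \<Longrightarrow> F + G \<in> commutant S"
  by (auto simp: commutant_iff bounded_ops_def compose_simps blinfun.add_left scaleC_add_right)

lemma commutant_minus: "F \<in> commutant S \<Longrightarrow> - F \<in> commutant S"
  by (auto simp: commutant_iff bounded_ops_def compose_simps blinfun.minus_left scaleC_minus_right)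

lemma commutant_diff: "F \<in> commutant S \<Longrightarrow> G \<in> commutant S \<Longrightarrow> F - G \<in> commutant S"
  using commutant_add[OF _ commutant_minus, of F S G] by simp

lemma commutant_compose:
  assumes "F \<in> commutant S" "G \<in> commutant S"
  shows "F o\<^sub>L G \<in> commutant S"
proof -
  have "(F o\<^sub>L G) o\<^sub>L H = H o\<^sub>L (F o\<^sub>L G)" if "H \<in> S" for H
    using assms that by (metis commutant_iff compose_assoc)
  then show ?thesis
    using assms by (auto simp: commutant_iff bounded_ops_def)
qed

lemma commutant_sum: "(\<And>i. i \<in> I \<Longrightarrow> f i \<in> commutant S) \<Longrightarrow> (\<Sum>i\<in>I. f i) \<in> commutant S"
  by (induction I rule: infinite_finite_induct) (auto intro: commutant_zero commutant_add)

lemma commutant_adj: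
  assumes F: "F \<in> commutant S" and S: "S \<subseteq> bounded_ops" "\<And>G. G \<in> S \<Longrightarrow> adj G \<in> S"
  shows "adj F \<in> commutant S"
proof -
  have Fb: "F \<in> bounded_ops"
    using F by (simp add: commutant_iff)
  have "adj F o\<^sub>L G = G o\<^sub>L adj F" if G: "G \<in> S" for G
  proof (rule blinfun_eqI, rule cinner_eqI)
    fix x y
    have Gb: "G \<in> bounded_ops"
      using S G by blast
    show "cinner y ((adj F o\<^sub>L G) x) = cinner y ((G o\<^sub>L adj F) x)"
      using commutant_apply[OF F S(2)[OF G], of y]
      by (simp flip: cinner_adj[OF Fb] cinner_adj_left[OF Gb])
  qed
  then show ?thesis
    using adj_bounded_ops[OF Fb] by (simp add: commutant_iff)
qed

lemma closed_fixed_points: "closed {x. blinfun_apply F x = blinfun_apply G x}"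
  by (intro closed_Collect_eq continuous_intros)

section \<open>Central projections and central supports\<close>

text \<open>
  A subspace invariant under a self-adjoint set of operators has an invariant orthogonal complement,
  so that the operators are block diagonal with respect to it.
\<close>

lemma commutes_with_projection:
  assumes S: "S \<subseteq> bounded_ops" "\<And>G. G \<in> S \<Longrightarrow> adj G \<in> S"
    and inv: "\<And>F x. F \<in> S \<Longrightarrow> x \<in> K \<Longrightarrow> blinfun_apply F x \<in> K"
    and p: "p \<in> bounded_ops" "\<And>x. blinfun_apply p x \<in> K" "\<And>x. x \<in> K \<Longrightarrow> blinfun_apply p x = x"
      "\<And>x y. y \<in> K \<Longrightarrow> cinner (x - blinfun_apply p x) y = 0"
  shows "p \<in> commutant S"
proof -
  have "p (F x) = F (p x)" if F: "F \<in> S" for F x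
  proof -
    have Fb: "F \<in> bounded_ops"
      using S F by blast
    \<comment> \<open>\<open>F\<close> preserves the orthogonal complement of \<open>K\<close>, since \<open>adj F\<close> preserves \<open>K\<close>; so \<open>p\<close> kills this image.\<close>
    have "cinner (p (F (x - p x))) (p (F (x - p x))) = 0"
    proof -
      let ?z = "F (x - p x)"
      have "cinner ?z (p ?z) = cinner (x - p x) (adj F (p ?z))"
        by (rule cinner_adj[OF Fb])
      also have "\<dots> = 0"
        by (rule p(4)) (simp add: inv S(2) F p(2))
      finally show ?thesis
        using p(4)[OF p(2), of ?z ?z] by (simp add: cinner_diff_left)
    qed
    then have "p (F (x - p x)) = 0"
      using cinner_eq_zero_iff by blast
    moreover have "p (F (p x)) = F (p x)"
      by (simp add: p inv F)
    ultimately show ?thesis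
      by (simp add: blinfun.diff_right)
  qed
  then show ?thesis
    using p(1) by (auto simp: commutant_iff intro: blinfun_eqI)
qed

locale vn_algebra =
  fixes M :: "('h::complex_hilbert_space \<Rightarrow>\<^sub>L 'h) set"
  assumes vn: "von_neumann_algebra M"
begin

lemma mem_bounded_ops: "F \<in> M \<Longrightarrow> F \<in> bounded_ops"
  using vn by (auto simp: von_neumann_algebra_def)

lemma adj_closed: "F \<in> M \<Longrightarrow> adj F \<in> M"
  using vn by (auto simp: von_neumann_algebra_def)

lemma bicommutant: "commutant (commutant M) = M"
  using vn by (auto simp: von_neumann_algebra_def)

lemma mem_iff: "F \<in> M \<longleftrightarrow> F \<in> commutant (commutant M)"
  by (simp add: bicommutant)

lemma zero_mem: "0 \<in> M"
  and id_mem: "id_blinfun \<in> M"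
  and minus_mem: "F \<in> M \<Longrightarrow> - F \<in> M"
  and diff_mem: "F \<in> M \<Longrightarrow> G \<in> M \<Longrightarrow> F - G \<in> M"
  and compose_mem: "F \<in> M \<Longrightarrow> G \<in> M \<Longrightarrow> F o\<^sub>L G \<in> M"
  and sum_mem: "(\<And>i. i \<in> I \<Longrightarrow> f i \<in> M) \<Longrightarrow> (\<Sum>i\<in>I. f i) \<in> M"
  by (simp_all add: mem_iff commutant_zero commutant_id commutant_minus commutant_diff
      commutant_compose commutant_sum)

abbreviation "CP \<equiv> central_projections M"

lemma CP_D:
  assumes "C \<in> CP"
  shows "C \<in> M" "C \<in> commutant M" "C o\<^sub>L C = C" "adj C = C"
  using assms by (auto simp: central_projections_def)

lemma CP_commute: "C \<in> CP \<Longrightarrow> F \<in> M \<Longrightarrow> C o\<^sub>L F = F o\<^sub>L C"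
  using CP_D(2) by (auto simp: commutant_iff)

lemma CP_commute_apply: "C \<in> CP \<Longrightarrow> F \<in> M \<Longrightarrow> C (F x) = F (C x)"
  using commutant_apply CP_D(2) by blast

lemma CP_commute_commutant_apply: "C \<in> CP \<Longrightarrow> F \<in> commutant M \<Longrightarrow> C (F x) = F (C x)"
  using commutant_apply CP_D(1) by metis

lemma CP_idem_apply: "C \<in> CP \<Longrightarrow> C (C x) = C x"
  using CP_D(3) by (metis blinfun_apply_blinfun_compose)

lemma CP_cinner: "C \<in> CP \<Longrightarrow> cinner (C x) y = cinner x (C y)"
  using cinner_adj[of C x y] CP_D mem_bounded_ops by metis

lemma CP_intro:
  assumes "C \<in> M" "C \<in> commutant M" "\<And>x. C (C x) = C x"
    "\<And>x y. cinner (blinfun_apply C x) y = cinner x (blinfun_apply C y)"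
  shows "C \<in> CP"
  using assms adj_eqI[of C C] by (auto simp: central_projections_def intro: blinfun_eqI)

lemma CP_id: "id_blinfun \<in> CP"
  by (rule CP_intro) (auto simp: id_mem commutant_id)

lemma CP_zero: "0 \<in> CP"
  by (rule CP_intro) (auto simp: zero_mem commutant_zero)

lemma CP_compose:
  assumes "C \<in> CP" "D \<in> CP" shows "C o\<^sub>L D \<in> CP"
proof (rule CP_intro)
  show "(C o\<^sub>L D) ((C o\<^sub>L D) x) = (C o\<^sub>L D) x" for x
    using assms by (simp add: CP_idem_apply CP_commute_apply[of D C, OF _ CP_D(1)])
  show "cinner ((C o\<^sub>L D) x) y = cinner x ((C o\<^sub>L D) y)" for x y
    using assms by (simp add: CP_cinner CP_commute_apply[of D C, OF _ CP_D(1)])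
qed (use assms in \<open>auto intro: compose_mem commutant_compose dest: CP_D\<close>)

lemma CP_complement:
  assumes "C \<in> CP" shows "id_blinfun - C \<in> CP"
proof (rule CP_intro)
  show "(id_blinfun - C) ((id_blinfun - C) x) = (id_blinfun - C) x" for x
    using assms by (simp add: blinfun.diff_left blinfun.diff_right CP_idem_apply)
  show "cinner ((id_blinfun - C) x) y = cinner x ((id_blinfun - C) y)" for x y
    using assms by (simp add: blinfun.diff_left cinner_diff_left cinner_diff_right CP_cinner)
qed (use assms in \<open>auto intro: diff_mem id_mem commutant_diff commutant_id dest: CP_D\<close>)

text \<open>
  Invariance under \<open>M\<close> and under its commutant puts the projection in \<open>M' \<inter> M'' = M' \<inter> M\<close>. This
  is the source of central supports, and of the central projections found by maximality arguments.
\<close>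

lemma invariant_subspace_projection:
  assumes K: "closed_csubspace K"
    and invM: "\<And>F x. F \<in> M \<Longrightarrow> x \<in> K \<Longrightarrow> blinfun_apply F x \<in> K"
    and invM': "\<And>F x. F \<in> commutant M \<Longrightarrow> x \<in> K \<Longrightarrow> blinfun_apply F x \<in> K"
  obtains p where "p \<in> CP" "\<And>x. blinfun_apply p x \<in> K" "\<And>x. x \<in> K \<Longrightarrow> blinfun_apply p x = x"
proof -
  obtain p where p: "p \<in> bounded_ops" "\<And>x. blinfun_apply p x \<in> K" "\<And>x. x \<in> K \<Longrightarrow> blinfun_apply p x = x"
      "\<And>x y. y \<in> K \<Longrightarrow> cinner (x - blinfun_apply p x) y = 0"
    using orthogonal_projection[OF K] by blast
  have "p \<in> commutant M"
    by (rule commutes_with_projection[OF _ _ invM p]) (auto simp: mem_bounded_ops adj_closed)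
  moreover have "p \<in> commutant (commutant M)"
  proof (rule commutes_with_projection[OF _ _ invM' p])
    show "commutant M \<subseteq> bounded_ops"
      by (auto simp: commutant_iff)
    show "adj G \<in> commutant M" if "G \<in> commutant M" for G
      using that by (rule commutant_adj) (auto simp: mem_bounded_ops adj_closed)
  qed
  moreover have "cinner (p x) y = cinner x (p y)" for x y
  proof -
    have "cinner (p x) (y - p y) = 0"
      using p(4)[OF p(2), of y x] cinner_commute[of "p x" "y - p y"] by simp
    then show ?thesis
      using p(4)[OF p(2), of x y] by (simp add: cinner_diff_left cinner_diff_right)
  qed
  ultimately have "p \<in> CP"
    using p by (intro CP_intro) (auto simp: bicommutant)
  then show thesis
    using that p by blast
qed

text \<open>
  The central support is the projection onto the intersection of the ranges of all central
  projections that fix \<open>Q\<close>.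
\<close>

lemma central_support_spec:
  "central_support M Q \<in> CP \<and> central_support M Q o\<^sub>L Q = Q \<and>
     (\<forall>D \<in> CP. D o\<^sub>L Q = Q \<longrightarrow> central_support M Q \<preceq> D)"
proof -
  define K where "K = (\<Inter>D\<in>{D \<in> CP. D o\<^sub>L Q = Q}. {x. blinfun_apply D x = blinfun_apply id_blinfun x})"
  have K_iff: "x \<in> K \<longleftrightarrow> (\<forall>D\<in>CP. D o\<^sub>L Q = Q \<longrightarrow> blinfun_apply D x = x)" for x
    by (auto simp: K_def)
  have "closed K"
    unfolding K_def by (intro closed_INT ballI closed_fixed_points)
  then have "closed_csubspace K"
    unfolding closed_csubspace_def
    by (simp add: K_iff blinfun.add_right bounded_opsD[OF mem_bounded_ops[OF CP_D(1)]])
  then obtain p where p: "p \<in> CP" "\<And>x. blinfun_apply p x \<in> K" "\<And>x. x \<in> K \<Longrightarrow> blinfun_apply p x = x"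
    by (rule invariant_subspace_projection) (auto simp: K_iff CP_commute_apply CP_commute_commutant_apply)
  have "Q x \<in> K" for x
    unfolding K_iff by (metis blinfun_apply_blinfun_compose)
  then have pQ: "p o\<^sub>L Q = Q"
    using p by (intro blinfun_eqI) simp
  have min: "p \<preceq> D" if "D \<in> CP" "D o\<^sub>L Q = Q" for D
  proof -
    have "D o\<^sub>L p = p"
      using p(2) that by (intro blinfun_eqI) (simp add: K_iff)
    then show ?thesis
      using CP_commute[OF p(1) CP_D(1)[OF that(1)]] by (simp add: idem_le_def)
  qed
  have "C = p" if "C \<in> CP" "C o\<^sub>L Q = Q" "\<forall>D \<in> CP. D o\<^sub>L Q = Q \<longrightarrow> C \<preceq> D" for C
  proof -
    have "p \<preceq> C" "C \<preceq> p"
      using min[OF that(1,2)] that(3) p(1) pQ by auto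
    then show ?thesis
      by (simp add: idem_le_def)
  qed
  then have "central_support M Q = p"
    unfolding central_support_def
    by (intro the_equality) (simp_all add: p(1) pQ min)
  then show ?thesis
    by (simp add: p(1) pQ min)
qed

abbreviation "cs \<equiv> central_support M"

lemma cs_CP: "cs Q \<in> CP"
  and cs_compose: "cs Q o\<^sub>L Q = Q"
  and cs_le: "D \<in> CP \<Longrightarrow> D o\<^sub>L Q = Q \<Longrightarrow> D o\<^sub>L cs Q = cs Q"
  using central_support_spec[of Q] by (auto simp: idem_le_def)

lemma cs_annihilated:
  assumes "D \<in> CP" "D o\<^sub>L Q = 0" shows "D o\<^sub>L cs Q = 0"
  using cs_le[OF CP_complement[OF assms(1)], of Q] assms(2) by (simp add: compose_simps)

section \<open>Idempotents that are full on a central projection\<close>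

text \<open>
  For central projections \<open>C\<close> this says that \<open>C\<close> is the central support of \<open>E\<close>. In this form it visibly
  survives cutting by a central projection.
\<close>

definition full_on :: "('h \<Rightarrow>\<^sub>L 'h) \<Rightarrow> ('h \<Rightarrow>\<^sub>L 'h) \<Rightarrow> bool" where
  "full_on E C \<longleftrightarrow> C o\<^sub>L E = E \<and> (\<forall>D\<in>CP. D o\<^sub>L E = 0 \<longrightarrow> D o\<^sub>L C = 0)"

lemma full_on_cs: "full_on Q (cs Q)"
  by (simp add: full_on_def cs_compose cs_annihilated)

lemma full_on_cut:
  assumes E: "full_on E C" and C: "C \<in> CP" and D: "D \<in> CP"
  shows "full_on (D o\<^sub>L E) (D o\<^sub>L C)"
proof -
  have "(D o\<^sub>L C) o\<^sub>L (D o\<^sub>L E) = D o\<^sub>L E"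
    using E CP_commute[OF C CP_D(1)[OF D]] CP_D(3)[OF D]
    by (metis compose_assoc full_on_def)
  moreover have "G o\<^sub>L (D o\<^sub>L C) = 0" if "G \<in> CP" "G o\<^sub>L (D o\<^sub>L E) = 0" for G
    using E that CP_compose[OF that(1) D] by (metis compose_assoc full_on_def)
  ultimately show ?thesis
    by (simp add: full_on_def)
qed

lemma full_on_nonzero:
  assumes "full_on E C" "C \<noteq> 0" shows "E \<noteq> 0"
  using assms CP_id by (auto simp: full_on_def)

text \<open>
  The vectors \<open>y\<close> with \<open>W (X y) = 0\<close> for all \<open>X \<in> M\<close> form the range of a central projection \<open>p\<close>. If this range
  contained that of \<open>E\<close>, then \<open>p\<close> would dominate \<open>C\<close>, and \<open>W\<close> would vanish.
\<close>

lemma full_on_connect: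
  assumes E: "full_on E C" and C: "C \<in> CP" and W: "W \<in> M" "C o\<^sub>L W = W" "W \<noteq> 0"
  shows "\<exists>X\<in>M. W o\<^sub>L (X o\<^sub>L E) \<noteq> 0"
proof (rule ccontr)
  assume "\<not> ?thesis"
  then have WXE: "W o\<^sub>L (X o\<^sub>L E) = 0" if "X \<in> M" for X
    using that by blast
  define K where "K = (\<Inter>X\<in>M. {y. blinfun_apply (W o\<^sub>L X) y = blinfun_apply 0 y})"
  have K_iff: "y \<in> K \<longleftrightarrow> (\<forall>X\<in>M. blinfun_apply W (blinfun_apply X y) = 0)" for y
    by (auto simp: K_def)
  have "closed K"
    unfolding K_def by (intro closed_INT ballI closed_fixed_points)
  then have "closed_csubspace K"
    unfolding closed_csubspace_def
    by (simp add: K_iff blinfun.add_right bounded_opsD[OF mem_bounded_ops] W)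
  then obtain p where p: "p \<in> CP" "\<And>x. blinfun_apply p x \<in> K" "\<And>x. x \<in> K \<Longrightarrow> blinfun_apply p x = x"
  proof (rule invariant_subspace_projection)
    show "F y \<in> K" if "F \<in> M" "y \<in> K" for F y
      unfolding K_iff
    proof
      fix X assume "X \<in> M"
      then show "W (X (F y)) = 0"
        using that compose_mem[of X F] by (metis K_iff blinfun_apply_blinfun_compose)
    qed
    show "F y \<in> K" if F: "F \<in> commutant M" and y: "y \<in> K" for F y
      unfolding K_iff
    proof
      fix X assume X: "X \<in> M"
      have "W (X (F y)) = F (W (X y))"
        using commutant_apply[OF F X, of y] commutant_apply[OF F W(1), of "X y"] by simp
      then show "W (X (F y)) = 0"
        using y X by (simp add: K_iff)
    qed
  qed blast
  have "E x \<in> K" for x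
    unfolding K_iff using WXE by (metis blinfun_apply_blinfun_compose zero_blinfun.rep_eq)
  then have "p o\<^sub>L E = E"
    using p by (intro blinfun_eqI) simp
  then have "(id_blinfun - p) o\<^sub>L E = 0"
    by (simp add: compose_simps)
  then have "(id_blinfun - p) o\<^sub>L C = 0"
    using E CP_complement[OF p(1)] by (simp add: full_on_def)
  then have pC: "p o\<^sub>L C = C"
    by (simp add: compose_simps)
  have "W x = 0" for x
  proof -
    have "W x = W (p (C x))"
      using W(2) CP_commute_apply[OF C W(1)] pC by (metis blinfun_apply_blinfun_compose)
    also have "\<dots> = W (id_blinfun (p (C x)))"
      by simp
    also have "\<dots> = 0"
      using p(2) id_mem unfolding K_iff by blast
    finally show ?thesis .
  qed
  then show False
    using W(3) by (auto intro: blinfun_eqI)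
qed

text \<open>
  The operator is \<open>W = E 0 o\<^sub>L X 1 o\<^sub>L E 1 o\<^sub>L \<dots> o\<^sub>L X m o\<^sub>L E m\<close>, with the \<open>X i\<close> chosen one after the other
  to keep the product nonzero; \<open>L i\<close> and \<open>R i\<close> are the parts to the left and right of \<open>E i\<close>.
\<close>

lemma full_on_chain:
  fixes m :: nat
  assumes C: "C \<in> CP" "C \<noteq> 0" and E: "\<And>i. i \<le> m \<Longrightarrow> E i \<in> M" "\<And>i. i \<le> m \<Longrightarrow> full_on (E i) C"
  shows "\<exists>W L R. W \<noteq> 0 \<and> (\<forall>i\<le>m. L i \<in> M \<and> R i \<in> M \<and> L i o\<^sub>L (E i o\<^sub>L R i) = W)"
  using E
proof (induction m)
  case 0
  then show ?case
    using full_on_nonzero[OF 0(2)[of 0] C(2)] id_mem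
    by (intro exI[of _ "E 0"] exI[of _ "\<lambda>_. id_blinfun"]) simp
next
  case (Suc m)
  then obtain W L R where W: "W \<noteq> 0" and
    LR: "\<And>i. i \<le> m \<Longrightarrow> L i \<in> M \<and> R i \<in> M \<and> L i o\<^sub>L (E i o\<^sub>L R i) = W"
    by (metis le_Suc_eq)
  have W0: "W = L 0 o\<^sub>L (E 0 o\<^sub>L R 0)"
    using LR[of 0] by simp
  then have WM: "W \<in> M"
    using LR[of 0] Suc.prems(1)[of 0] by (auto intro: compose_mem)
  have "C o\<^sub>L E 0 = E 0"
    using Suc.prems(2)[of 0] by (simp add: full_on_def)
  then have "C o\<^sub>L W = W"
    unfolding W0 using CP_commute[OF C(1), of "L 0"] LR[of 0] by (metis compose_assoc le0)
  then obtain X where X: "X \<in> M" "W o\<^sub>L (X o\<^sub>L E (Suc m)) \<noteq> 0"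
    using full_on_connect[OF Suc.prems(2)[of "Suc m"] C(1) WM _ W] by blast
  define L' where "L' = (\<lambda>i. if i \<le> m then L i else W o\<^sub>L X)"
  define R' where "R' = (\<lambda>i. if i \<le> m then R i o\<^sub>L (X o\<^sub>L E (Suc m)) else id_blinfun)"
  have "L' i \<in> M \<and> R' i \<in> M \<and> L' i o\<^sub>L (E i o\<^sub>L R' i) = W o\<^sub>L (X o\<^sub>L E (Suc m))" if i: "i \<le> Suc m" for i
  proof (cases "i \<le> m")
    case True
    then show ?thesis
      using LR[OF True] X(1) Suc.prems(1)[of "Suc m"]
      by (auto simp: L'_def R'_def compose_assoc[symmetric] intro!: compose_mem)
  next
    case False
    then have "i = Suc m"
      using i by simp
    then show ?thesis
      using X(1) WM id_mem by (auto simp: L'_def R'_def compose_assoc intro: compose_mem)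
  qed
  then show ?case
    using X(2) by blast
qed

end

section \<open>Patching along orthogonal central projections\<close>

lemma sum_orthogonal_norm:
  fixes f :: "'i \<Rightarrow> 'a::complex_hilbert_space"
  assumes "finite F" "\<And>i j. i \<in> F \<Longrightarrow> j \<in> F \<Longrightarrow> i \<noteq> j \<Longrightarrow> cinner (f i) (f j) = 0"
  shows "(norm (\<Sum>i\<in>F. f i))\<^sup>2 = (\<Sum>i\<in>F. (norm (f i))\<^sup>2)"
  using assms
proof (induction F)
  case (insert i F)
  have "cinner (\<Sum>j\<in>F. f j) (- f i) = 0"
    using insert by (auto simp: cinner_sum_left cinner_minus_right intro!: sum.neutral)
  then have "(norm ((\<Sum>j\<in>F. f j) - - f i))\<^sup>2 = (norm (\<Sum>j\<in>F. f j))\<^sup>2 + (norm (f i))\<^sup>2"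
    using norm_orthogonal_diff by (metis norm_minus_cancel)
  then show ?case
    using insert by (simp add: add.commute)
qed simp

text \<open>
  By Pythagoras the Cauchy condition for the vectors is the Cauchy condition for the squares of
  their norms.
\<close>

lemma orthogonal_family_summable:
  fixes f :: "'i \<Rightarrow> 'a::complex_hilbert_space"
  assumes orth: "\<And>i j. i \<in> I \<Longrightarrow> j \<in> I \<Longrightarrow> i \<noteq> j \<Longrightarrow> cinner (f i) (f j) = 0"
    and bnd: "\<And>F. finite F \<Longrightarrow> F \<subseteq> I \<Longrightarrow> (\<Sum>i\<in>F. (norm (f i))\<^sup>2) \<le> b\<^sup>2" and b: "0 \<le> b"
  shows "f summable_on I" "norm (infsum f I) \<le> b"
proof -
  let ?q = "\<lambda>i. (norm (f i))\<^sup>2"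
  have q: "?q summable_on I"
    using bnd by (intro nonneg_bdd_above_summable_on) (auto simp: bdd_above_def)
  have pyth: "(norm (sum f F))\<^sup>2 = sum ?q F" if "finite F" "F \<subseteq> I" for F
    using that orth by (intro sum_orthogonal_norm) auto
  have "\<exists>P. eventually P (finite_subsets_at_top I) \<and>
      (\<forall>F G. P F \<and> P G \<longrightarrow> dist (sum f F) (sum f G) < e)" if e: "e > 0" for e
  proof -
    have "(e / 3)\<^sup>2 > 0"
      using e by simp
    then obtain F0 where F0: "finite F0" "F0 \<subseteq> I" "dist (sum ?q F0) (infsum ?q I) \<le> (e / 3)\<^sup>2"
      using infsum_finite_approximation[OF q] by blast
    define P where "P F \<longleftrightarrow> finite F \<and> F0 \<subseteq> F \<and> F \<subseteq> I" for F
    have near: "dist (sum f F) (sum f F0) \<le> e / 3" if "P F" for F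
    proof -
      have "(dist (sum f F) (sum f F0))\<^sup>2 = (norm (sum f (F - F0)))\<^sup>2"
        using that by (simp add: P_def dist_norm sum_diff)
      also have "\<dots> = sum ?q F - sum ?q F0"
        using that pyth[of "F - F0"] by (auto simp: P_def sum_diff)
      also have "\<dots> \<le> (e / 3)\<^sup>2"
        using F0(3) finite_sum_le_infsum[OF q, of F] that by (auto simp: P_def dist_real_def)
      finally show ?thesis
        by (rule power2_le_imp_le) (use e in simp)
    qed
    have "dist (sum f F) (sum f G) < e" if "P F" "P G" for F G
      using dist_triangle2[of "sum f F" "sum f G" "sum f F0"] near[OF that(1)] near[OF that(2)] e by linarith
    moreover have "eventually P (finite_subsets_at_top I)"
      using F0 by (auto simp: eventually_finite_subsets_at_top P_def)
    ultimately show ?thesis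
      by blast
  qed
  then have "cauchy_filter (filtermap (sum f) (finite_subsets_at_top I))"
    by (simp add: cauchy_filter_metric_filtermap)
  moreover have "complete (UNIV :: 'a set)"
    by (meson Cauchy_convergent UNIV_I complete_def convergent_def)
  ultimately obtain l where "(sum f \<longlongrightarrow> l) (finite_subsets_at_top I)"
    using complete_uniform[where S = UNIV] by (force simp: filterlim_def)
  then show sm: "f summable_on I"
    using summable_on_def has_sum_def by blast
  show "norm (infsum f I) \<le> b"
  proof (rule tendsto_upperbound)
    show "((\<lambda>F. norm (sum f F)) \<longlongrightarrow> norm (infsum f I)) (finite_subsets_at_top I)"
      using has_sum_infsum[OF sm] by (intro tendsto_norm) (simp add: has_sum_def)
    show "\<forall>\<^sub>F F in finite_subsets_at_top I. norm (sum f F) \<le> b"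
      using pyth bnd b
      by (intro eventually_finite_subsets_at_top_weakI) (metis power2_le_imp_le)
  qed simp
qed

context vn_algebra
begin

lemma CP_orthogonal_ranges:
  assumes "C \<in> CP" "D \<in> CP" "C o\<^sub>L D = 0"
  shows "cinner (C x) (D y) = 0"
proof -
  have "C (D y) = 0"
    using assms(3) by (metis blinfun_apply_blinfun_compose zero_blinfun.rep_eq)
  then show ?thesis
    by (simp add: CP_cinner[OF assms(1)])
qed

lemma CP_Bessel:
  assumes F: "finite F" "F \<subseteq> CP" and orth: "\<And>C D. C \<in> F \<Longrightarrow> D \<in> F \<Longrightarrow> C \<noteq> D \<Longrightarrow> C o\<^sub>L D = 0"
  shows "(\<Sum>C\<in>F. (norm (blinfun_apply C x))\<^sup>2) \<le> (norm x)\<^sup>2"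
proof -
  define s where "s = (\<Sum>C\<in>F. blinfun_apply C x)"
  have s: "(norm s)\<^sup>2 = (\<Sum>C\<in>F. (norm (blinfun_apply C x))\<^sup>2)"
    unfolding s_def using F orth by (intro sum_orthogonal_norm) (auto simp: CP_orthogonal_ranges subset_iff)
  have "cinner x s = (\<Sum>C\<in>F. complex_of_real ((norm (blinfun_apply C x))\<^sup>2))"
    unfolding s_def cinner_sum_right
  proof (rule sum.cong)
    fix C assume "C \<in> F"
    then have "C \<in> CP"
      using F by blast
    then show "cinner x (C x) = complex_of_real ((norm (C x))\<^sup>2)"
      by (metis CP_cinner CP_idem_apply cinner_self)
  qed simp
  then have "cinner x s = complex_of_real ((norm s)\<^sup>2)"
    by (simp add: s)
  then have "(norm (x - s))\<^sup>2 = (norm x)\<^sup>2 - (norm s)\<^sup>2"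
    by (simp add: norm_diff_squared)
  then show ?thesis
    unfolding s[symmetric] by (metis diff_ge_0_iff_ge zero_le_power2)
qed

text \<open>
  The operator is the strong sum of the \<open>X C o\<^sub>L C\<close>. It converges because these terms map into the
  orthogonal ranges of the \<open>C\<close> and are uniformly bounded; the uniform bound is what property \<open>(J)\<close>
  provides. The sum is taken pointwise, so it commutes with the commutant of \<open>M\<close>.
\<close>

lemma central_patching:
  assumes CC: "\<C> \<subseteq> CP" and orth: "\<And>C D. C \<in> \<C> \<Longrightarrow> D \<in> \<C> \<Longrightarrow> C \<noteq> D \<Longrightarrow> C o\<^sub>L D = 0"
    and X: "\<And>C. C \<in> \<C> \<Longrightarrow> X C \<in> M" "\<And>C. C \<in> \<C> \<Longrightarrow> norm (X C) \<le> b"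
  shows "\<exists>Y\<in>M. \<forall>C\<in>\<C>. Y o\<^sub>L C = X C o\<^sub>L C"
proof -
  define B where "B = max b 0"
  have B: "0 \<le> B" "\<And>C. C \<in> \<C> \<Longrightarrow> norm (X C) \<le> B"
    using X(2) by (auto simp: B_def le_max_iff_disj)
  define f where "f x C = blinfun_apply (X C) (blinfun_apply C x)" for x C
  define Y where "Y x = infsum (f x) \<C>" for x
  have f_orth: "cinner (f x C) (f x D) = 0" if CD: "C \<in> \<C>" "D \<in> \<C>" "C \<noteq> D" for x C D
  proof -
    have "f x C' = C' (X C' x)" if "C' \<in> \<C>" for C'
      unfolding f_def using that CC X(1) by (intro CP_commute_apply[symmetric]) auto
    then have "f x C = C (X C x)" "f x D = D (X D x)"
      using CD by auto
    then show ?thesis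
      using CP_orthogonal_ranges orth CD CC by (metis subsetD)
  qed
  have f_bnd: "(\<Sum>C\<in>F. (norm (f x C))\<^sup>2) \<le> (B * norm x)\<^sup>2" if F: "finite F" "F \<subseteq> \<C>" for x F
  proof -
    have "(\<Sum>C\<in>F. (norm (f x C))\<^sup>2) \<le> (\<Sum>C\<in>F. B\<^sup>2 * (norm (blinfun_apply C x))\<^sup>2)"
    proof (rule sum_mono)
      fix C assume "C \<in> F"
      then have "norm (f x C) \<le> B * norm (C x)"
        unfolding f_def using B F norm_blinfun order_trans mult_right_mono
        by (metis norm_ge_zero subsetD)
      then show "(norm (f x C))\<^sup>2 \<le> B\<^sup>2 * (norm (C x))\<^sup>2"
        by (metis norm_ge_zero power_mono power_mult_distrib)
    qed
    also have "\<dots> \<le> B\<^sup>2 * (norm x)\<^sup>2"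
      unfolding sum_distrib_left[symmetric]
    proof (intro mult_left_mono CP_Bessel)
      show "C o\<^sub>L D = 0" if "C \<in> F" "D \<in> F" "C \<noteq> D" for C D
        using that F orth by blast
    qed (use F CC in auto)
    finally show ?thesis
      by (simp add: power_mult_distrib)
  qed
  note summable = orthogonal_family_summable[OF f_orth f_bnd mult_nonneg_nonneg[OF B(1) norm_ge_zero]]
  have hs: "((f x) has_sum Y x) \<C>" for x
    unfolding Y_def by (rule has_sum_infsum[OF summable(1)])
  have image: "Y (G x) = h (Y x)" if "bounded_linear h" "\<And>C. C \<in> \<C> \<Longrightarrow> f (G x) C = h (f x C)" for G h x
  proof -
    have "((f (G x)) has_sum s) \<C> \<longleftrightarrow> ((\<lambda>C. h (f x C)) has_sum s) \<C>" for s
      by (rule has_sum_cong) (rule that(2))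
    then have "((f (G x)) has_sum h (Y x)) \<C>"
      using has_sum_bounded_linear[OF that(1) hs[of x]] by blast
    then show ?thesis
      using hs has_sum_unique by blast
  qed
  have add: "Y (x + y) = Y x + Y y" for x y
  proof -
    have "((\<lambda>C. f x C + f y C) has_sum Y x + Y y) \<C>"
      by (rule has_sum_add[OF hs hs])
    moreover have "f (x + y) = (\<lambda>C. f x C + f y C)"
      by (rule ext) (simp add: f_def blinfun.add_right)
    ultimately have "((f (x + y)) has_sum Y x + Y y) \<C>"
      by simp
    then show ?thesis
      using hs has_sum_unique by blast
  qed
  have scale: "Y (c *\<^sub>C x) = c *\<^sub>C Y x" for c x
  proof (rule image)
    have "(\<lambda>x :: 'h. c *\<^sub>C x) = blinfun_apply (scaleC_op c id_blinfun)"
      by (simp add: fun_eq_iff scaleC_op_apply)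
    then show "bounded_linear (\<lambda>x :: 'h. c *\<^sub>C x)"
      by (simp add: blinfun.bounded_linear_right)
    show "f (c *\<^sub>C x) C = c *\<^sub>C f x C" if "C \<in> \<C>" for C
      using that CC X(1) CP_D(1) by (auto simp: f_def bounded_opsD[OF mem_bounded_ops] subset_iff)
  qed
  have bl: "bounded_linear Y"
  proof (rule bounded_linear_intro[where K = B])
    show "Y (r *\<^sub>R x) = r *\<^sub>R Y x" for r x
      by (simp only: scaleR_eq_scaleC scale)
    show "norm (Y x) \<le> norm x * B" for x
      unfolding Y_def mult.commute[of "norm x"] by (rule summable(2))
  qed (rule add)
  have app: "blinfun_apply (Blinfun Y) = Y"
    using bl by (rule bounded_linear_Blinfun_apply)
  have "Blinfun Y \<in> commutant (commutant M)"
  proof -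
    have "Y (G x) = G (Y x)" if G: "G \<in> commutant M" for G x
    proof (rule image)
      show "f (G x) C = G (f x C)" if "C \<in> \<C>" for C
        unfolding f_def using that G CC X(1) CP_D(1) commutant_apply[OF G] by (metis subsetD)
    qed (rule blinfun.bounded_linear_right)
    then show ?thesis
      by (auto simp: commutant_iff[of _ "commutant M"] bounded_ops_def app scale intro: blinfun_eqI)
  qed
  moreover have "Blinfun Y o\<^sub>L D = X D o\<^sub>L D" if D: "D \<in> \<C>" for D
  proof (rule blinfun_eqI)
    fix x
    have "f (D x) C = 0" if "C \<in> \<C> - {D}" for C
      using orth[of C D] that D unfolding f_def
      by (metis DiffD1 DiffD2 blinfun.zero_right blinfun_apply_blinfun_compose singletonI zero_blinfun.rep_eq)
    then have "((f (D x)) has_sum f (D x) D) \<C>"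
      using D by (intro has_sum_finite_neutralI[where B = "{D}"]) auto
    then have "Y (D x) = f (D x) D"
      using hs has_sum_unique by blast
    then show "(Blinfun Y o\<^sub>L D) x = (X D o\<^sub>L D) x"
      using D CC by (auto simp: app f_def CP_idem_apply subset_iff)
  qed
  ultimately show ?thesis
    using bicommutant by blast
qed

text \<open>
  The conclusion states that \<open>\<C>\<close> has supremum the identity in the form in which it is used: members of \<open>M\<close>
  may be compared locally. The common kernel of a maximal orthogonal family is the range of a central
  projection, which must vanish since otherwise the family could be enlarged below it.
\<close>

lemma central_exhaustion:
  assumes G: "\<And>C. C \<in> CP \<Longrightarrow> C \<noteq> 0 \<Longrightarrow> \<exists>D\<in>CP. D \<noteq> 0 \<and> C o\<^sub>L D = D \<and> G D"
  obtains \<C> where "\<C> \<subseteq> {D \<in> CP. G D}"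
    "\<And>C D. C \<in> \<C> \<Longrightarrow> D \<in> \<C> \<Longrightarrow> C \<noteq> D \<Longrightarrow> C o\<^sub>L D = 0"
    "\<And>F H. F \<in> M \<Longrightarrow> H \<in> M \<Longrightarrow> (\<And>C. C \<in> \<C> \<Longrightarrow> C o\<^sub>L F = C o\<^sub>L H) \<Longrightarrow> F = H"
proof -
  define \<F> where "\<F> = {\<C>. \<C> \<subseteq> {D \<in> CP. D \<noteq> 0 \<and> G D} \<and> (\<forall>C\<in>\<C>. \<forall>D\<in>\<C>. C \<noteq> D \<longrightarrow> C o\<^sub>L D = 0)}"
  have "\<exists>\<C>\<in>\<F>. \<forall>X\<in>\<F>. \<C> \<subseteq> X \<longrightarrow> X = \<C>"
  proof (rule subset_Zorn')
    fix \<K> assume chain: "subset.chain \<F> \<K>"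
    have "C o\<^sub>L D = 0" if "A \<in> \<K>" "C \<in> A" "B \<in> \<K>" "D \<in> B" "C \<noteq> D" for A B C D
    proof -
      have "A \<in> \<F>" "B \<in> \<F>" "A \<subseteq> B \<or> B \<subseteq> A"
        using chain that by (auto simp: subset_chain_def)
      then show ?thesis
        using that unfolding \<F>_def by blast
    qed
    moreover have "\<K> \<subseteq> \<F>"
      using chain by (simp add: subset_chain_def)
    ultimately show "\<Union>\<K> \<in> \<F>"
      unfolding \<F>_def by blast
  qed
  then obtain \<C> where \<C>: "\<C> \<in> \<F>" and max: "\<And>X. X \<in> \<F> \<Longrightarrow> \<C> \<subseteq> X \<Longrightarrow> X = \<C>"
    by blast
  have CC: "C \<in> CP" if "C \<in> \<C>" for C
    using that \<C> by (auto simp: \<F>_def)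
  define K where "K = (\<Inter>C\<in>\<C>. {x. blinfun_apply C x = blinfun_apply 0 x})"
  have K_iff: "x \<in> K \<longleftrightarrow> (\<forall>C\<in>\<C>. blinfun_apply C x = 0)" for x
    by (auto simp: K_def)
  have "closed K"
    unfolding K_def by (intro closed_INT ballI closed_fixed_points)
  then have "closed_csubspace K"
    unfolding closed_csubspace_def
    by (simp add: K_iff blinfun.add_right bounded_opsD[OF mem_bounded_ops[OF CP_D(1)]] CC)
  then obtain p where p: "p \<in> CP" "\<And>x. blinfun_apply p x \<in> K" "\<And>x. x \<in> K \<Longrightarrow> blinfun_apply p x = x"
    by (rule invariant_subspace_projection)
      (auto simp: K_iff CP_commute_apply CP_commute_commutant_apply CC)
  have Cp: "C o\<^sub>L p = 0" if "C \<in> \<C>" for C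
    using p(2) that by (intro blinfun_eqI) (simp add: K_iff)
  have p0: "p = 0"
  proof (rule ccontr)
    assume "p \<noteq> 0"
    then obtain D where D: "D \<in> CP" "D \<noteq> 0" "p o\<^sub>L D = D" "G D"
      using G[OF p(1)] by blast
    have CD: "C o\<^sub>L D = 0" if "C \<in> \<C>" for C
      using Cp[OF that] D(3) by (metis blinfun_compose_zero(1) compose_assoc)
    then have "D o\<^sub>L C = 0" if "C \<in> \<C>" for C
      using CP_commute[OF D(1) CP_D(1)[OF CC[OF that]]] that by simp
    then have "insert D \<C> \<in> \<F>"
      using \<C> D CD by (auto simp: \<F>_def)
    then have "D \<in> \<C>"
      using max by blast
    then show False
      using CD CP_D(3)[OF D(1)] D(2) by auto
  qed
  show thesis
  proof (rule that[of \<C>])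
    show "C o\<^sub>L D = 0" if "C \<in> \<C>" "D \<in> \<C>" "C \<noteq> D" for C D
      using \<C> that by (auto simp: \<F>_def)
    show "\<C> \<subseteq> {D \<in> CP. G D}"
      using \<C> by (auto simp: \<F>_def)
    show "F = H" if "F \<in> M" "H \<in> M" and eq: "\<And>C. C \<in> \<C> \<Longrightarrow> C o\<^sub>L F = C o\<^sub>L H" for F H
    proof (rule blinfun_eqI)
      fix x
      have "C (F x - H x) = 0" if "C \<in> \<C>" for C
        using arg_cong[OF eq[OF that], of "\<lambda>G. blinfun_apply G x"] by (simp add: blinfun.diff_right)
      then have "p (F x - H x) = F x - H x"
        by (intro p(3)) (simp add: K_iff)
      then show "F x = H x"
        by (simp add: p0)
    qed
  qed
qed

section \<open>Finiteness of matrix algebras over abelian algebras\<close>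

text \<open>
  Elements of an abelian von Neumann algebra are normal, and a nilpotent normal operator is zero.
\<close>

lemma reduced:
  assumes comm: "pairwise_commuting M" and a: "a \<in> M" "a o\<^sub>L a = 0"
  shows "a = 0"
proof (rule blinfun_eqI)
  fix x
  have ab: "a \<in> bounded_ops"
    using a mem_bounded_ops by blast
  have aa: "a (a y) = 0" for y
    using a(2) by (metis blinfun_apply_blinfun_compose zero_blinfun.rep_eq)
  have "a (adj a y) = adj a (a y)" for y
    using comm a adj_closed by (metis pairwise_commuting_def blinfun_apply_blinfun_compose)
  then have "cinner (adj a (a x)) (adj a (a x)) = 0"
    by (simp add: cinner_adj_left[OF ab] aa blinfun.zero_right)
  then have "adj a (a x) = 0"
    using cinner_eq_zero_iff by blast
  then have "cinner (a x) (a x) = 0"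
    using cinner_adj[OF ab, of x "a x"] by simp
  then have "a x = 0"
    using cinner_eq_zero_iff by blast
  then show "a x = blinfun_apply 0 x"
    by simp
qed

text \<open>
  Gaussian elimination. Over a field the relation would only have to be nontrivial; over a reduced ring it
  must be nontrivial where \<open>w\<close> does not vanish, and this is the form that survives the induction.
  If \<open>w o\<^sub>L c \<noteq> 0\<close> for some last coordinate \<open>c\<close>, it serves as pivot, and the induction continues with
  \<open>w o\<^sub>L c\<close>, which amounts to inverting \<open>c\<close>. Otherwise multiplying
  the vectors by \<open>w\<close> removes their last coordinates.
\<close>

lemma linear_dependence:
  fixes v :: "'i \<Rightarrow> nat \<Rightarrow> ('h \<Rightarrow>\<^sub>L 'h)"
  assumes comm: "pairwise_commuting M"
  shows "finite I \<Longrightarrow> n < card I \<Longrightarrow> (\<And>i k. i \<in> I \<Longrightarrow> k < n \<Longrightarrow> v i k \<in> M) \<Longrightarrow> w \<in> M \<Longrightarrow> w \<noteq> 0 \<Longrightarrow>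
    \<exists>a. (\<forall>i\<in>I. a i \<in> M) \<and> (\<forall>k<n. (\<Sum>i\<in>I. a i o\<^sub>L v i k) = 0) \<and> (\<exists>i\<in>I. w o\<^sub>L a i \<noteq> 0)"
proof (induction n arbitrary: I w v)
  case 0
  then have "I \<noteq> {}"
    by auto
  then show ?case
    using 0 id_mem by (intro exI[of _ "\<lambda>_. id_blinfun"]) auto
next
  case (Suc n)
  have commute: "F o\<^sub>L G = G o\<^sub>L F" if "F \<in> M" "G \<in> M" for F G
    using comm that by (auto simp: pairwise_commuting_def)
  show ?case
  proof (cases "\<forall>i\<in>I. w o\<^sub>L v i n = 0")
    case True
    have "\<exists>a. (\<forall>i\<in>I. a i \<in> M) \<and> (\<forall>k<n. (\<Sum>i\<in>I. a i o\<^sub>L v i k) = 0) \<and> (\<exists>i\<in>I. w o\<^sub>L a i \<noteq> 0)"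
      by (rule Suc.IH) (use Suc.prems in auto)
    then obtain a i where a: "\<And>i. i \<in> I \<Longrightarrow> a i \<in> M" "\<And>k. k < n \<Longrightarrow> (\<Sum>i\<in>I. a i o\<^sub>L v i k) = 0"
      and i: "i \<in> I" "w o\<^sub>L a i \<noteq> 0"
      by auto
    have "(\<Sum>i\<in>I. (w o\<^sub>L a i) o\<^sub>L v i k) = 0" if k: "k < Suc n" for k
    proof (cases "k = n")
      case True
      show ?thesis
      proof (rule sum.neutral, rule ballI)
        fix j assume j: "j \<in> I"
        have "(w o\<^sub>L a j) o\<^sub>L v j k = a j o\<^sub>L (w o\<^sub>L v j k)"
          using commute[OF Suc.prems(4) a(1)[OF j]] by (simp add: compose_assoc)
        then show "(w o\<^sub>L a j) o\<^sub>L v j k = 0"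
          using \<open>\<forall>i\<in>I. w o\<^sub>L v i n = 0\<close> True j by simp
      qed
    next
      case False
      then have "w o\<^sub>L (\<Sum>i\<in>I. a i o\<^sub>L v i k) = 0"
        using a(2) k by simp
      then show ?thesis
        by (simp add: compose_simps compose_assoc)
    qed
    moreover have "w o\<^sub>L (w o\<^sub>L a i) \<noteq> 0"
    proof
      assume "w o\<^sub>L (w o\<^sub>L a i) = 0"
      then have "(w o\<^sub>L a i) o\<^sub>L (w o\<^sub>L a i) = 0"
        using commute[OF Suc.prems(4) a(1)[OF i(1)]]
        by (metis compose_assoc blinfun_compose_zero(2))
      then show False
        using reduced[OF comm] i Suc.prems(4) a(1) compose_mem by blast
    qed
    ultimately show ?thesis
      using a(1) i Suc.prems(4) compose_mem
      by (intro exI[of _ "\<lambda>i. w o\<^sub>L a i"]) blast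
  next
    case False
    then obtain p where p: "p \<in> I" "w o\<^sub>L v p n \<noteq> 0"
      by blast
    define c where "c = v p n"
    define u where "u i k = (c o\<^sub>L v i k) - (v i n o\<^sub>L v p k)" for i k
    have vM: "v i k \<in> M" if "i \<in> I" "k \<le> n" for i k
      using Suc.prems(3) that by simp
    have cM: "c \<in> M"
      using vM p by (simp add: c_def)
    have "n < card (I - {p})"
      using Suc.prems(1,2) p by simp
    moreover have "u i k \<in> M" if "i \<in> I - {p}" "k < n" for i k
      using that p cM vM by (auto simp: u_def intro!: diff_mem compose_mem)
    moreover have "w o\<^sub>L c \<in> M" "w o\<^sub>L c \<noteq> 0"
      using p cM Suc.prems(4) by (auto simp: c_def intro: compose_mem)
    ultimately have "\<exists>a. (\<forall>i\<in>I - {p}. a i \<in> M) \<and> (\<forall>k<n. (\<Sum>i\<in>I - {p}. a i o\<^sub>L u i k) = 0) \<and>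
        (\<exists>i\<in>I - {p}. (w o\<^sub>L c) o\<^sub>L a i \<noteq> 0)"
      using Suc.prems(1) by (intro Suc.IH) simp_all
    then obtain a i where a: "\<And>i. i \<in> I - {p} \<Longrightarrow> a i \<in> M"
        "\<And>k. k < n \<Longrightarrow> (\<Sum>i\<in>I - {p}. a i o\<^sub>L u i k) = 0"
      and i: "i \<in> I - {p}" "(w o\<^sub>L c) o\<^sub>L a i \<noteq> 0"
      by meson
    define a' where "a' j = (if j = p then - (\<Sum>i\<in>I - {p}. a i o\<^sub>L v i n) else a j o\<^sub>L c)" for j
    have "(\<Sum>j\<in>I. a' j o\<^sub>L v j k) = 0" if k: "k < Suc n" for k
    proof -
      have "(\<Sum>j\<in>I. a' j o\<^sub>L v j k) = (a' p o\<^sub>L v p k) + (\<Sum>j\<in>I - {p}. a' j o\<^sub>L v j k)"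
        using p Suc.prems(1) by (simp add: sum.remove)
      also have "(\<Sum>j\<in>I - {p}. a' j o\<^sub>L v j k) = (\<Sum>j\<in>I - {p}. a j o\<^sub>L (c o\<^sub>L v j k))"
        by (rule sum.cong) (auto simp: a'_def compose_assoc)
      also have "a' p o\<^sub>L v p k = - (\<Sum>j\<in>I - {p}. a j o\<^sub>L (v j n o\<^sub>L v p k))"
        by (simp add: a'_def compose_simps compose_assoc)
      also have "\<dots> + (\<Sum>j\<in>I - {p}. a j o\<^sub>L (c o\<^sub>L v j k)) = (\<Sum>j\<in>I - {p}. a j o\<^sub>L u j k)"
        by (simp add: u_def compose_simps sum_subtractf)
      also have "\<dots> = 0"
      proof (cases "k = n")
        case True
        have "u j n = 0" if "j \<in> I - {p}" for j
          using commute[OF cM vM[of j n]] that by (simp add: u_def c_def)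
        then show ?thesis
          using True by simp
      qed (use a(2) k in simp)
      finally show ?thesis .
    qed
    moreover have "a' j \<in> M" if "j \<in> I" for j
      using that a(1) vM cM by (auto simp: a'_def intro!: minus_mem sum_mem compose_mem)
    moreover have "w o\<^sub>L a' i \<noteq> 0"
      using i commute[OF cM a(1)[OF i(1)]] by (auto simp: a'_def compose_assoc)
    ultimately show ?thesis
      using i by blast
  qed
qed

text \<open>
  Pointwise over the spectrum of \<open>A\<close> this is the fact that \<open>n\<close>-dimensional space does not contain
  \<open>n + 1\<close> independent nonzero subspaces.
\<close>

lemma type_I_finiteness:
  fixes A :: "('k::complex_hilbert_space \<Rightarrow>\<^sub>L 'k) set"
  assumes t: "type_I_via n A M" and C: "C \<in> CP" "C \<noteq> 0"
    and E: "\<And>i. i \<le> n \<Longrightarrow> E i \<in> M" "\<And>i. i \<le> n \<Longrightarrow> E i o\<^sub>L E i = E i"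
    and orth: "\<And>i j. i \<le> n \<Longrightarrow> j \<le> n \<Longrightarrow> i \<noteq> j \<Longrightarrow> E i o\<^sub>L E j = 0"
    and full: "\<And>i. i \<le> n \<Longrightarrow> full_on (E i) C"
  shows False
proof -
  interpret A: vn_algebra A
    using t by unfold_locales (simp add: type_I_via_def)
  have comm: "pairwise_commuting A"
    using t by (simp add: type_I_via_def)
  obtain \<phi> where \<phi>: "star_iso_matrices n M A \<phi>"
    using t by (auto simp: type_I_via_def)
  then have bij: "bij_betw \<phi> M (matrices n A)"
    and add: "\<And>F G. F \<in> M \<Longrightarrow> G \<in> M \<Longrightarrow> \<phi> (F + G) = (\<lambda>i j. \<phi> F i j + \<phi> G i j)"
    and mult: "\<And>F G. F \<in> M \<Longrightarrow> G \<in> M \<Longrightarrow> \<phi> (F o\<^sub>L G) = (\<lambda>i j. \<Sum>k<n. \<phi> F i k o\<^sub>L \<phi> G k j)"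
    by (simp_all add: star_iso_matrices_def)
  have mat: "\<phi> F \<in> matrices n A" if "F \<in> M" for F
    using bij that bij_betwE by blast
  have entry: "\<phi> F i j \<in> A" if "F \<in> M" "i < n" "j < n" for F i j
    using mat[OF that(1)] that(2,3) unfolding matrices_def by (metis (mono_tags, lifting) mem_Collect_eq)
  have outside: "\<phi> F i j = 0" if "F \<in> M" "\<not> (i < n \<and> j < n)" for F i j
    using mat[OF that(1)] that(2) unfolding matrices_def by (metis (mono_tags, lifting) mem_Collect_eq)
  have zero: "\<phi> 0 i j = 0" for i j
  proof -
    have "\<phi> 0 i j = \<phi> 0 i j + \<phi> 0 i j"
      using fun_cong[OF fun_cong[OF add[OF zero_mem zero_mem]], of i j] by simp
    then show ?thesis
      by simp
  qed
  obtain W L R where W: "W \<noteq> 0" and LR: "\<And>i. i \<le> n \<Longrightarrow> L i \<in> M" "\<And>i. i \<le> n \<Longrightarrow> R i \<in> M"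
      "\<And>i. i \<le> n \<Longrightarrow> L i o\<^sub>L (E i o\<^sub>L R i) = W"
    using full_on_chain[of C n E, OF C E(1) full] by blast
  have WM: "W \<in> M"
    using LR[of 0] E(1)[of 0] compose_mem by (metis le0)
  obtain p q where pq: "\<phi> W p q \<noteq> 0"
  proof (rule ccontr)
    assume "\<not> thesis"
    then have "\<phi> W = \<phi> 0"
      using that zero by (auto simp: fun_eq_iff)
    then show False
      using W WM zero_mem bij by (auto simp: bij_betw_def inj_on_def)
  qed
  then have pq_n: "p < n" "q < n"
    using outside[OF WM, of p q] by auto
  define w where "w = \<phi> W p q"
  have wA: "w \<in> A" "w \<noteq> 0"
    using pq pq_n entry WM by (auto simp: w_def)
  have ER: "E i o\<^sub>L R i \<in> M" and LE: "L i o\<^sub>L E i \<in> M" if "i \<le> n" for i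
    using LR E(1) compose_mem that by auto
  have "\<exists>a. (\<forall>i\<in>{..n}. a i \<in> A) \<and> (\<forall>k<n. (\<Sum>i\<in>{..n}. a i o\<^sub>L \<phi> (E i o\<^sub>L R i) k q) = 0) \<and>
      (\<exists>i\<in>{..n}. w o\<^sub>L a i \<noteq> 0)"
    by (rule A.linear_dependence[OF comm]) (simp_all add: wA entry ER pq_n)
  then obtain a i where a: "\<And>i. i \<in> {..n} \<Longrightarrow> a i \<in> A"
      "\<And>k. k < n \<Longrightarrow> (\<Sum>i\<in>{..n}. a i o\<^sub>L \<phi> (E i o\<^sub>L R i) k q) = 0"
    and "i \<in> {..n}" and wa: "w o\<^sub>L a i \<noteq> 0"
    by meson
  then have i: "i \<le> n"
    by simp
  have commute: "F o\<^sub>L G = G o\<^sub>L F" if "F \<in> A" "G \<in> A" for F G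
    using comm that by (auto simp: pairwise_commuting_def)
  have prod: "(L i o\<^sub>L E i) o\<^sub>L (E j o\<^sub>L R j) = (if j = i then W else 0)" if "j \<le> n" for j
  proof -
    have "(L i o\<^sub>L E i) o\<^sub>L (E j o\<^sub>L R j) = L i o\<^sub>L ((E i o\<^sub>L E j) o\<^sub>L R j)"
      by (simp add: compose_assoc)
    then show ?thesis
      using E(2)[OF i] LR(3)[OF i] orth[OF i(1) that] by auto
  qed
  have "0 = (\<Sum>k<n. \<phi> (L i o\<^sub>L E i) p k o\<^sub>L (\<Sum>j\<in>{..n}. a j o\<^sub>L \<phi> (E j o\<^sub>L R j) k q))"
    by (simp add: a(2))
  also have "\<dots> = (\<Sum>k<n. \<Sum>j\<in>{..n}. a j o\<^sub>L (\<phi> (L i o\<^sub>L E i) p k o\<^sub>L \<phi> (E j o\<^sub>L R j) k q))"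
  proof (rule sum.cong[OF refl], unfold compose_simps, rule sum.cong[OF refl])
    fix k j assume "k \<in> {..<n}" "j \<in> {..n}"
    then have "\<phi> (L i o\<^sub>L E i) p k \<in> A" "a j \<in> A"
      using entry LE[OF i] pq_n a(1) by auto
    then show "\<phi> (L i o\<^sub>L E i) p k o\<^sub>L (a j o\<^sub>L \<phi> (E j o\<^sub>L R j) k q)
        = a j o\<^sub>L (\<phi> (L i o\<^sub>L E i) p k o\<^sub>L \<phi> (E j o\<^sub>L R j) k q)"
      using commute by (simp add: compose_assoc[symmetric])
  qed
  also have "\<dots> = (\<Sum>j\<in>{..n}. a j o\<^sub>L (\<Sum>k<n. \<phi> (L i o\<^sub>L E i) p k o\<^sub>L \<phi> (E j o\<^sub>L R j) k q))"
    by (subst sum.swap) (simp add: compose_simps)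
  also have "\<dots> = (\<Sum>j\<in>{..n}. a j o\<^sub>L \<phi> ((L i o\<^sub>L E i) o\<^sub>L (E j o\<^sub>L R j)) p q)"
    using mult[OF LE[OF i] ER] by simp
  also have "\<dots> = (\<Sum>j\<in>{..n}. if j = i then a i o\<^sub>L w else 0)"
    by (rule sum.cong) (auto simp: prod zero w_def)
  also have "\<dots> = a i o\<^sub>L w"
    using i by simp
  also have "\<dots> = w o\<^sub>L a i"
    using commute wA(1) a(1) i by blast
  finally show False
    using wa by simp
qed

end

section \<open>Idempotents commuting with an operator\<close>

lemma idem_le_iff: "Q \<preceq> P \<longleftrightarrow> P o\<^sub>L Q = Q \<and> Q o\<^sub>L P = Q"
  by (metis idem_le_def)

context vn_algebra
begin

lemma norm_CP_le: assumes "C \<in> CP" shows "norm C \<le> 1"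
proof (rule norm_blinfun_bound)
  show "norm (C x) \<le> 1 * norm x" for x
    using CP_Bessel[of "{C}" x] assms by (auto intro: power2_le_imp_le)
qed simp

lemma cs_cut:
  assumes C: "C \<in> CP" shows "cs (C o\<^sub>L Q) = C o\<^sub>L cs Q"
proof -
  let ?D = "cs (C o\<^sub>L Q)"
  have full: "full_on (C o\<^sub>L Q) (C o\<^sub>L cs Q)"
    by (rule full_on_cut[OF full_on_cs cs_CP C])
  have CP: "C o\<^sub>L cs Q \<in> CP"
    by (rule CP_compose[OF C cs_CP])
  have "(C o\<^sub>L cs Q) o\<^sub>L ?D = ?D"
    using full by (intro cs_le[OF CP]) (simp add: full_on_def)
  moreover have "(id_blinfun - ?D) o\<^sub>L (C o\<^sub>L Q) = 0"
    by (simp add: compose_simps cs_compose)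
  then have "(id_blinfun - ?D) o\<^sub>L (C o\<^sub>L cs Q) = 0"
    using full CP_complement[OF cs_CP] by (simp add: full_on_def)
  then have "C o\<^sub>L cs Q = ?D o\<^sub>L (C o\<^sub>L cs Q)"
    by (simp add: compose_simps)
  ultimately show ?thesis
    using CP_commute[OF CP CP_D(1)[OF cs_CP], of "C o\<^sub>L Q"] by simp
qed

end

locale vn_operator = vn_algebra M for M :: "('h::complex_hilbert_space \<Rightarrow>\<^sub>L 'h) set" +
  fixes T :: "'h \<Rightarrow>\<^sub>L 'h"
  assumes T: "T \<in> M"
begin

abbreviation "Idem \<equiv> idempotents (commutant {T} \<inter> M)"

lemma Idem_iff: "P \<in> Idem \<longleftrightarrow> P \<in> M \<and> P o\<^sub>L T = T o\<^sub>L P \<and> P o\<^sub>L P = P"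
  using mem_bounded_ops by (auto simp: idempotents_def commutant_iff)

lemma Idem_M: "P \<in> Idem \<Longrightarrow> P \<in> M"
  by (simp add: Idem_iff)

lemma CP_Idem: "C \<in> CP \<Longrightarrow> C \<in> Idem"
  using T CP_commute CP_D by (simp add: Idem_iff)

lemma Idem_compose:
  assumes "P \<in> Idem" "Q \<in> Idem" "P o\<^sub>L Q = Q o\<^sub>L P" shows "P o\<^sub>L Q \<in> Idem"
proof -
  have "(P o\<^sub>L Q) o\<^sub>L (P o\<^sub>L Q) = (P o\<^sub>L P) o\<^sub>L (Q o\<^sub>L Q)"
    using assms(3) by (metis compose_assoc)
  moreover have "(P o\<^sub>L Q) o\<^sub>L T = T o\<^sub>L (P o\<^sub>L Q)"
    using assms by (metis Idem_iff compose_assoc)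
  ultimately show ?thesis
    using assms by (simp add: Idem_iff compose_mem)
qed

lemma Idem_diff:
  assumes "P \<in> Idem" "Q \<in> Idem" "Q \<preceq> P" shows "P - Q \<in> Idem"
  using assms by (auto simp: Idem_iff idem_le_iff compose_simps diff_mem)

lemma Idem_sum:
  assumes "\<And>i. i \<in> I \<Longrightarrow> P i \<in> Idem" "\<And>i j. i \<in> I \<Longrightarrow> j \<in> I \<Longrightarrow> i \<noteq> j \<Longrightarrow> P i o\<^sub>L P j = 0"
  shows "(\<Sum>i\<in>I. P i) \<in> Idem"
proof (cases "finite I")
  case True
  have "(\<Sum>i\<in>I. P i) o\<^sub>L (\<Sum>i\<in>I. P i) = (\<Sum>i\<in>I. \<Sum>j\<in>I. P i o\<^sub>L P j)"
    unfolding compose_sum_left unfolding compose_sum_right ..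
  also have "\<dots> = (\<Sum>i\<in>I. \<Sum>j\<in>I. if j = i then P i else 0)"
    using assms by (intro sum.cong refl) (auto simp: Idem_iff)
  also have "\<dots> = (\<Sum>i\<in>I. P i)"
    using True by simp
  finally show ?thesis
    using assms(1) by (auto simp: Idem_iff sum_mem compose_simps intro: sum.cong)
qed (use CP_Idem CP_zero in simp)

text \<open>
  The maximal family generated by a decomposition consists of its central combinations.
\<close>

lemma decomposition_imp_property_J:
  assumes "has_finite_SI_decomposition M T"
  shows "property_J M T"
proof -
  obtain m P where min: "\<And>j. j \<in> {1..m::nat} \<Longrightarrow> centrally_minimal M T (P j)"
    and sum: "(\<Sum>j=1..m. P j) = id_blinfun"
    and orth: "\<And>j k. j \<in> {1..m} \<Longrightarrow> k \<in> {1..m} \<Longrightarrow> j \<noteq> k \<Longrightarrow> P j o\<^sub>L P k = 0"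
    using assms unfolding has_finite_SI_decomposition_def by blast
  have P: "P j \<in> Idem" if "j \<in> {1..m}" for j
    using min[OF that] by (simp add: centrally_minimal_def)
  define S where "S C = (\<Sum>j=1..m. P j o\<^sub>L C j)" for C :: "nat \<Rightarrow> ('h \<Rightarrow>\<^sub>L 'h)"
  define \<P> where "\<P> = S ` {C. \<forall>j\<in>{1..m}. C j \<in> CP}"
  have mult: "S C o\<^sub>L S D = S (\<lambda>j. C j o\<^sub>L D j)"
    if C: "\<forall>j\<in>{1..m}. C j \<in> CP" and D: "\<forall>j\<in>{1..m}. D j \<in> CP" for C D
  proof -
    have "S C o\<^sub>L S D = (\<Sum>i=1..m. \<Sum>j=1..m. (P i o\<^sub>L C i) o\<^sub>L (P j o\<^sub>L D j))"
      unfolding S_def compose_sum_left unfolding compose_sum_right ..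
    also have "\<dots> = (\<Sum>i=1..m. \<Sum>j=1..m. if j = i then P i o\<^sub>L (C i o\<^sub>L D i) else 0)"
    proof (intro sum.cong refl)
      fix i j assume ij: "i \<in> {1..m}" "j \<in> {1..m}"
      have "(P i o\<^sub>L C i) o\<^sub>L (P j o\<^sub>L D j) = (P i o\<^sub>L P j) o\<^sub>L (C i o\<^sub>L D j)"
        using CP_commute[of "C i" "P j"] C P ij Idem_M by (metis compose_assoc)
      then show "(P i o\<^sub>L C i) o\<^sub>L (P j o\<^sub>L D j) = (if j = i then P i o\<^sub>L (C i o\<^sub>L D i) else 0)"
        using orth[OF ij] P[OF ij(1)] by (auto simp: Idem_iff)
    qed
    also have "\<dots> = S (\<lambda>j. C j o\<^sub>L D j)"
      by (simp add: S_def)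
    finally show ?thesis .
  qed
  have comm: "S C o\<^sub>L S D = S D o\<^sub>L S C"
    if C: "\<forall>j\<in>{1..m}. C j \<in> CP" and D: "\<forall>j\<in>{1..m}. D j \<in> CP" for C D
    using mult[OF C D] mult[OF D C] C D CP_commute CP_D(1) by (simp add: S_def)
  have "S C \<in> Idem" if C: "\<forall>j\<in>{1..m}. C j \<in> CP" for C
  proof -
    have "S C o\<^sub>L S C = S C"
      using mult[OF C C] C CP_D(3) by (simp add: S_def)
    moreover have "S C \<in> M"
      using C P Idem_M CP_D(1) unfolding S_def by (intro sum_mem compose_mem) auto
    moreover have "(P j o\<^sub>L C j) o\<^sub>L T = T o\<^sub>L (P j o\<^sub>L C j)" if "j \<in> {1..m}" for j
      using C P[OF that] that T CP_commute[of "C j" T] by (metis Idem_iff compose_assoc)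
    then have "S C o\<^sub>L T = T o\<^sub>L S C"
      by (simp add: S_def compose_simps)
    ultimately show ?thesis
      by (simp add: Idem_iff)
  qed
  then have abelian: "abelian_idempotent_family M T \<P>"
    using comm by (auto simp: abelian_idempotent_family_def pairwise_commuting_def \<P>_def)
  have "norm (S C) \<le> (\<Sum>j=1..m. norm (P j))" if C: "\<forall>j\<in>{1..m}. C j \<in> CP" for C
    unfolding S_def
  proof (rule sum_norm_le)
    fix j assume "j \<in> {1..m}"
    then have "norm (P j) * norm (C j) \<le> norm (P j) * 1"
      using C norm_CP_le by (intro mult_left_mono) auto
    then show "norm (P j o\<^sub>L C j) \<le> norm (P j)"
      using norm_blinfun_compose[of "P j" "C j"] by simp
  qed
  then have bdd: "bounded \<P>"
    unfolding bounded_iff \<P>_def by blast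
  have "\<Q> = \<P>" if \<Q>: "abelian_idempotent_family M T \<Q>" "\<P> \<subseteq> \<Q>" for \<Q>
  proof -
    have "Q \<in> \<P>" if Q: "Q \<in> \<Q>" for Q
    proof -
      have QI: "Q \<in> Idem"
        using \<Q> Q by (auto simp: abelian_idempotent_family_def)
      \<comment> \<open>\<open>P j\<close> is itself a central combination, so \<open>Q\<close> commutes with it, and \<open>Q o\<^sub>L P j\<close> is an idempotent below it.\<close>
      have QP: "Q o\<^sub>L P j = P j o\<^sub>L cs (Q o\<^sub>L P j)" if j: "j \<in> {1..m}" for j
      proof -
        have "P j = S (\<lambda>i. if i = j then id_blinfun else 0)"
          using j by (simp add: S_def if_distrib cong: if_cong)
        then have "P j \<in> \<Q>"
          using \<Q>(2) by (auto simp: \<P>_def CP_id CP_zero)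
        then have c: "Q o\<^sub>L P j = P j o\<^sub>L Q"
          using \<Q>(1) Q by (auto simp: abelian_idempotent_family_def pairwise_commuting_def)
        have "Q o\<^sub>L P j \<preceq> P j"
          using c P[OF j] unfolding idem_le_iff by (metis Idem_iff compose_assoc)
        then show ?thesis
          using min[OF j] Idem_compose[OF QI P[OF j] c] by (auto simp: centrally_minimal_def)
      qed
      have "Q = (\<Sum>j=1..m. Q o\<^sub>L P j)"
        using arg_cong[OF sum, of "\<lambda>F. Q o\<^sub>L F"] by (simp add: compose_simps)
      also have "\<dots> = S (\<lambda>j. cs (Q o\<^sub>L P j))"
        unfolding S_def by (intro sum.cong refl QP)
      finally show ?thesis
        using cs_CP by (auto simp: \<P>_def)
    qed
    then show ?thesis
      using \<Q>(2) by blast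
  qed
  then show ?thesis
    unfolding property_J_def using abelian bdd by blast
qed

end

section \<open>Maximal abelian families of idempotents\<close>

locale maximal_family = vn_operator M T
  for M :: "('h::complex_hilbert_space \<Rightarrow>\<^sub>L 'h) set" and T :: "'h \<Rightarrow>\<^sub>L 'h" +
  fixes \<P> :: "('h \<Rightarrow>\<^sub>L 'h) set"
  assumes abelian: "abelian_idempotent_family M T \<P>"
    and maximal: "\<And>\<Q>. abelian_idempotent_family M T \<Q> \<Longrightarrow> \<P> \<subseteq> \<Q> \<Longrightarrow> \<Q> = \<P>"
begin

lemma family_Idem: "P \<in> \<P> \<Longrightarrow> P \<in> Idem"
  using abelian by (auto simp: abelian_idempotent_family_def)

lemma family_M: "P \<in> \<P> \<Longrightarrow> P \<in> M"
  using family_Idem Idem_M by blast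

lemma family_commute: "P \<in> \<P> \<Longrightarrow> Q \<in> \<P> \<Longrightarrow> P o\<^sub>L Q = Q o\<^sub>L P"
  using abelian by (auto simp: abelian_idempotent_family_def pairwise_commuting_def)

lemma family_intro:
  assumes "Q \<in> Idem" "\<And>R. R \<in> \<P> \<Longrightarrow> Q o\<^sub>L R = R o\<^sub>L Q"
  shows "Q \<in> \<P>"
proof -
  have "abelian_idempotent_family M T (insert Q \<P>)"
    using assms abelian by (auto simp: abelian_idempotent_family_def pairwise_commuting_def)
  then show ?thesis
    using maximal by blast
qed

lemma family_CP: "C \<in> CP \<Longrightarrow> C \<in> \<P>"
  by (rule family_intro[OF CP_Idem]) (auto intro: CP_commute dest: family_M)

lemma family_compose:
  assumes "P \<in> \<P>" "Q \<in> \<P>" shows "P o\<^sub>L Q \<in> \<P>"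
proof (rule family_intro)
  show "P o\<^sub>L Q \<in> Idem"
    using assms by (intro Idem_compose family_Idem family_commute)
  show "(P o\<^sub>L Q) o\<^sub>L R = R o\<^sub>L (P o\<^sub>L Q)" if "R \<in> \<P>" for R
    using assms that family_commute by (metis compose_assoc)
qed

lemma family_diff:
  assumes "P \<in> \<P>" "Q \<in> \<P>" "Q \<preceq> P" shows "P - Q \<in> \<P>"
  using assms
  by (intro family_intro[OF Idem_diff]) (simp_all add: family_Idem compose_simps family_commute)

lemma family_sum:
  assumes "\<And>i. i \<in> I \<Longrightarrow> P i \<in> \<P>" "\<And>i j. i \<in> I \<Longrightarrow> j \<in> I \<Longrightarrow> i \<noteq> j \<Longrightarrow> P i o\<^sub>L P j = 0"
  shows "(\<Sum>i\<in>I. P i) \<in> \<P>"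
proof (rule family_intro)
  show "(\<Sum>i\<in>I. P i) \<in> Idem"
    using assms by (intro Idem_sum family_Idem)
  show "(\<Sum>i\<in>I. P i) o\<^sub>L R = R o\<^sub>L (\<Sum>i\<in>I. P i)" if "R \<in> \<P>" for R
    unfolding compose_simps using assms(1) that by (intro sum.cong refl family_commute)
qed

text \<open>
  Every member of \<open>\<P>\<close> cuts \<open>E\<close> to a central multiple of \<open>E\<close>. So an idempotent below \<open>E\<close> commutes with all
  of \<open>\<P>\<close>, and belongs to it by maximality.
\<close>

lemma minimal_in_family_imp_centrally_minimal:
  assumes E: "E \<in> \<P>" and min: "\<And>Q. Q \<in> \<P> \<Longrightarrow> Q \<preceq> E \<Longrightarrow> Q = E o\<^sub>L cs Q"
  shows "centrally_minimal M T E"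
proof -
  have "Q = E o\<^sub>L cs Q" if Q: "Q \<in> Idem" "Q \<preceq> E" for Q
  proof (rule min)
    show "Q \<in> \<P>"
    proof (rule family_intro[OF Q(1)])
      fix R assume R: "R \<in> \<P>"
      define D where "D = cs (E o\<^sub>L R)"
      have ER: "E o\<^sub>L R = R o\<^sub>L E"
        by (rule family_commute[OF E R])
      have "E o\<^sub>L R \<preceq> E"
        using ER family_Idem[OF E] unfolding idem_le_iff by (metis Idem_iff compose_assoc)
      then have ED: "E o\<^sub>L R = E o\<^sub>L D"
        unfolding D_def by (intro min family_compose E R)
      have D: "D o\<^sub>L F = F o\<^sub>L D" if "F \<in> M" for F
        unfolding D_def by (rule CP_commute[OF cs_CP that])
      have "Q o\<^sub>L R = Q o\<^sub>L (E o\<^sub>L R)"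
        using Q(2) by (metis idem_le_iff compose_assoc)
      also have "\<dots> = Q o\<^sub>L D"
        using Q(2) ED by (metis idem_le_iff compose_assoc)
      also have "\<dots> = D o\<^sub>L Q"
        using D[OF Idem_M[OF Q(1)]] by simp
      also have "\<dots> = (D o\<^sub>L E) o\<^sub>L Q"
        using Q(2) by (metis idem_le_iff compose_assoc)
      also have "\<dots> = (R o\<^sub>L E) o\<^sub>L Q"
        using D[OF family_M[OF E]] ED ER by simp
      also have "\<dots> = R o\<^sub>L Q"
        using Q(2) by (metis idem_le_iff compose_assoc)
      finally show "Q o\<^sub>L R = R o\<^sub>L Q" .
    qed
  qed (rule Q(2))
  then show ?thesis
    using family_Idem[OF E] by (simp add: centrally_minimal_def)
qed

lemma zero_centrally_minimal: "centrally_minimal M T 0"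
  by (rule minimal_in_family_imp_centrally_minimal) (auto simp: family_CP CP_zero idem_le_iff)

definition full_system :: "nat \<Rightarrow> ('h \<Rightarrow>\<^sub>L 'h) \<Rightarrow> (nat \<Rightarrow> ('h \<Rightarrow>\<^sub>L 'h)) \<Rightarrow> bool" where
  "full_system k D E \<longleftrightarrow> D \<in> CP \<and> D \<noteq> 0 \<and> (\<forall>i<k. E i \<in> \<P> \<and> full_on (E i) D) \<and>
     (\<forall>i<k. \<forall>j<k. i \<noteq> j \<longrightarrow> E i o\<^sub>L E j = 0)"

text \<open>
  Here \<open>0\<close> is admitted as a value of \<open>E\<close>, so that all central projections that split do so into the
  same number \<open>n\<close> of pieces, which is what patching requires.
\<close>

definition splits :: "nat \<Rightarrow> ('h \<Rightarrow>\<^sub>L 'h) \<Rightarrow> (nat \<Rightarrow> ('h \<Rightarrow>\<^sub>L 'h)) \<Rightarrow> bool" where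
  "splits n C E \<longleftrightarrow> (\<forall>i<n. E i \<in> \<P> \<and> centrally_minimal M T (E i)) \<and>
     (\<forall>i<n. \<forall>j<n. i \<noteq> j \<longrightarrow> E i o\<^sub>L E j = 0) \<and> (\<Sum>i<n. E i) = C"

lemma orthogonal_cut:
  assumes D: "D \<in> CP" and P: "P \<in> M" "P o\<^sub>L Q = 0"
  shows "(D o\<^sub>L P) o\<^sub>L (D o\<^sub>L Q) = 0"
  using CP_commute[OF D P(1)] P(2) by (metis compose_assoc blinfun_compose_zero(2))

text \<open>
  Both claims of a splitting follow from the impossibility of a longer system: the remainder of the sum would
  be a further member over its own central support, and an idempotent \<open>Q\<close> below \<open>E i\<close> whose central support
  overlaps that of \<open>E i - Q\<close> would allow \<open>E i\<close> to be replaced by two members over the overlap.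
\<close>

lemma full_system_maximal_splits:
  assumes sys: "full_system k D E"
    and max: "\<And>D' F. full_system (Suc k) D' F \<Longrightarrow> D o\<^sub>L D' = D' \<Longrightarrow> False"
  shows "splits k D E"
proof -
  have D: "D \<in> CP" "D \<noteq> 0" and E: "\<And>i. i < k \<Longrightarrow> E i \<in> \<P>" "\<And>i. i < k \<Longrightarrow> full_on (E i) D"
    and orth: "\<And>i j. i < k \<Longrightarrow> j < k \<Longrightarrow> i \<noteq> j \<Longrightarrow> E i o\<^sub>L E j = 0"
    using sys by (auto simp: full_system_def)
  have DE: "D o\<^sub>L E i = E i" "E i o\<^sub>L D = E i" "E i o\<^sub>L E i = E i" if "i < k" for i
    using E[OF that] CP_commute[OF D(1) family_M[OF E(1)[OF that]]] family_Idem[OF E(1)[OF that]]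
    by (auto simp: full_on_def Idem_iff)
  have refine: False
    if D': "D' \<in> CP" "D o\<^sub>L D' = D'" "D' \<noteq> 0" and B: "\<And>j. j < Suc k \<Longrightarrow> B j \<in> \<P>"
      and full: "\<And>j. j < Suc k \<Longrightarrow> full_on (D' o\<^sub>L B j) D'"
      and Bo: "\<And>j l. j < Suc k \<Longrightarrow> l < Suc k \<Longrightarrow> j \<noteq> l \<Longrightarrow> B j o\<^sub>L B l = 0"
    for D' B
  proof -
    have "full_system (Suc k) D' (\<lambda>j. D' o\<^sub>L B j)"
      unfolding full_system_def
      using D' B full Bo by (simp add: family_compose family_CP orthogonal_cut family_M)
    then show False
      using max D'(2) by blast
  qed
  have E_full: "full_on (D' o\<^sub>L E j) D'" if "j < k" "D' \<in> CP" "D o\<^sub>L D' = D'" for j D'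
  proof -
    have "full_on (D' o\<^sub>L E j) (D' o\<^sub>L D)"
      using that by (intro full_on_cut E(2) D(1))
    then show ?thesis
      using that(3) CP_commute[OF D(1) CP_D(1)[OF that(2)]] by simp
  qed
  \<comment> \<open>A remainder \<open>G\<close> would be a further full member over its central support.\<close>
  define S where "S = (\<Sum>i<k. E i)"
  define G where "G = D - S"
  have SP: "S \<in> \<P>"
    unfolding S_def using E(1) orth by (intro family_sum) auto
  have DS: "D o\<^sub>L S = S" "S o\<^sub>L D = S"
    using DE by (simp_all add: S_def compose_simps)
  then have GP: "G \<in> \<P>"
    unfolding G_def using SP family_CP[OF D(1)] by (intro family_diff) (simp_all add: idem_le_iff)
  have ES: "E i o\<^sub>L S = E i" if "i < k" for i
  proof -
    have "E i o\<^sub>L S = (\<Sum>j<k. if j = i then E i else 0)"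
      unfolding S_def compose_simps using that orth DE(3) by (intro sum.cong) auto
    then show ?thesis
      using that by simp
  qed
  have EG: "E i o\<^sub>L G = 0" "G o\<^sub>L E i = 0" if "i < k" for i
  proof -
    show "E i o\<^sub>L G = 0"
      using ES[OF that] DE[OF that] by (simp add: G_def compose_simps)
    then show "G o\<^sub>L E i = 0"
      using family_commute[OF GP E(1)[OF that]] by simp
  qed
  have "G = 0"
  proof (rule ccontr)
    assume "G \<noteq> 0"
    then have "cs G \<noteq> 0"
      using cs_compose[of G] by auto
    have "D o\<^sub>L G = G"
      using DS CP_D(3)[OF D(1)] by (simp add: G_def compose_simps)
    then have D': "D o\<^sub>L cs G = cs G"
      by (rule cs_le[OF D(1)])
    show False
    proof (rule refine[OF cs_CP D' \<open>cs G \<noteq> 0\<close>])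
      show "(E(k := G)) j \<in> \<P>" if "j < Suc k" for j
        using that GP E(1) by simp
      show "full_on (cs G o\<^sub>L (E(k := G)) j) (cs G)" if "j < Suc k" for j
        using that full_on_cs[of G] E_full[OF _ cs_CP D'] by (simp add: cs_compose)
      show "(E(k := G)) j o\<^sub>L (E(k := G)) l = 0" if "j < Suc k" "l < Suc k" "j \<noteq> l" for j l
        using that EG orth by auto
    qed
  qed
  then have sum: "(\<Sum>i<k. E i) = D"
    by (simp add: G_def S_def)
  have "centrally_minimal M T (E i)" if i: "i < k" for i
  proof (rule minimal_in_family_imp_centrally_minimal[OF E(1)[OF i]])
    fix Q assume Q: "Q \<in> \<P>" "Q \<preceq> E i"
    define R where "R = E i - Q"
    have RP: "R \<in> \<P>"
      unfolding R_def by (rule family_diff[OF E(1)[OF i] Q])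
    have EQ: "E i o\<^sub>L Q = Q" "Q o\<^sub>L E i = Q" "Q o\<^sub>L Q = Q"
      using Q family_Idem[OF Q(1)] by (auto simp: idem_le_iff Idem_iff)
    have QR: "Q o\<^sub>L R = 0" "R o\<^sub>L Q = 0"
      using EQ by (simp_all add: R_def compose_simps)
    have Qo: "Q o\<^sub>L E j = 0" "E j o\<^sub>L Q = 0" if "j < k" "j \<noteq> i" for j
    proof -
      show "Q o\<^sub>L E j = 0"
        using EQ orth[of i j] i that by (metis compose_assoc blinfun_compose_zero(2))
      then show "E j o\<^sub>L Q = 0"
        using family_commute[OF Q(1) E(1)[OF that(1)]] by simp
    qed
    then have Ro: "R o\<^sub>L E j = 0" "E j o\<^sub>L R = 0" if "j < k" "j \<noteq> i" for j
      using orth i that by (simp_all add: R_def compose_simps)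
    define D' where "D' = cs Q o\<^sub>L cs R"
    have D'CP: "D' \<in> CP"
      unfolding D'_def by (intro CP_compose cs_CP)
    have "D o\<^sub>L Q = Q"
      using DE(1)[OF i] EQ(1) by (metis compose_assoc)
    then have "D o\<^sub>L cs Q = cs Q"
      by (rule cs_le[OF D(1)])
    then have DD': "D o\<^sub>L D' = D'"
      by (simp add: D'_def compose_assoc[symmetric])
    have comm: "cs Q o\<^sub>L cs R = cs R o\<^sub>L cs Q"
      by (rule CP_commute[OF cs_CP CP_D(1)[OF cs_CP]])
    have "D' o\<^sub>L cs Q = D'" "D' o\<^sub>L cs R = D'"
      using CP_D(3)[OF cs_CP, of Q] CP_D(3)[OF cs_CP, of R] comm
      unfolding D'_def by (metis compose_assoc)+
    then have full: "full_on (D' o\<^sub>L Q) D'" "full_on (D' o\<^sub>L R) D'"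
      using full_on_cut[OF full_on_cs cs_CP D'CP] by metis+
    \<comment> \<open>Over \<open>D'\<close> both parts of \<open>E i\<close> are full, so they would form a system with one more member.\<close>
    have "D' = 0"
    proof (rule ccontr)
      assume D'0: "D' \<noteq> 0"
      define B where "B = E(i := R, k := Q)"
      show False
      proof (rule refine[OF D'CP DD' D'0])
        show "B j \<in> \<P>" if "j < Suc k" for j
          using that Q(1) RP E(1) by (auto simp: B_def)
        show "full_on (D' o\<^sub>L B j) D'" if "j < Suc k" for j
          using that full E_full[OF _ D'CP DD'] by (auto simp: B_def)
        show "B j o\<^sub>L B l = 0" if "j < Suc k" "l < Suc k" "j \<noteq> l" for j l
          using that QR Qo Ro orth by (auto simp: B_def)
      qed
    qed
    then have "cs Q o\<^sub>L R = 0"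
      using cs_compose[of R] unfolding D'_def by (metis compose_assoc blinfun_compose_zero(1))
    then have "cs Q o\<^sub>L E i = Q"
      using cs_compose[of Q] by (simp add: R_def compose_simps)
    then show "Q = E i o\<^sub>L cs Q"
      using CP_commute[OF cs_CP family_M[OF E(1)[OF i]]] by simp
  qed
  then show ?thesis
    using E(1) orth sum by (auto simp: splits_def)
qed

text \<open>
  The length of a system below \<open>C\<close> is bounded, so a longest one exists. The systems below its projection \<open>D\<close>
  are also below \<open>C\<close>, so it is longest below \<open>D\<close> too.
\<close>

lemma splits_below:
  assumes bound: "\<And>k D E. full_system k D E \<Longrightarrow> k \<le> n" and C: "C \<in> CP" "C \<noteq> 0"
  shows "\<exists>D\<in>CP. D \<noteq> 0 \<and> C o\<^sub>L D = D \<and> (\<exists>E. splits n D E)"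
proof -
  define S where "S k \<longleftrightarrow> (\<exists>D E. full_system k D E \<and> C o\<^sub>L D = D)" for k
  have "S 0"
    unfolding S_def full_system_def using C CP_D(3) by (intro exI[of _ C]) simp
  moreover have "\<And>k. S k \<Longrightarrow> k \<le> n"
    using bound by (auto simp: S_def)
  ultimately obtain k where k: "S k" "\<And>l. S l \<Longrightarrow> l \<le> k"
    using GreatestI_nat[of S 0 n] Greatest_le_nat[of S _ n] by metis
  then obtain D E where sys: "full_system k D E" and CD: "C o\<^sub>L D = D"
    by (auto simp: S_def)
  have "splits k D E"
  proof (rule full_system_maximal_splits[OF sys])
    fix D' F assume F: "full_system (Suc k) D' F" "D o\<^sub>L D' = D'"
    have "C o\<^sub>L D' = D'"
      using CD F(2) by (metis compose_assoc)
    then have "S (Suc k)"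
      using F(1) by (auto simp: S_def)
    then show False
      using k(2) by fastforce
  qed
  moreover have "k \<le> n"
    by (rule bound[OF sys])
  ultimately have "splits n D (\<lambda>i. if i < k then E i else 0)"
  proof -
    assume E: "splits k D E" and "k \<le> n"
    have "{..<n} \<inter> {i. i < k} = {..<k}"
      using \<open>k \<le> n\<close> by auto
    then have "(\<Sum>i<n. if i < k then E i else 0) = (\<Sum>i<k. E i)"
      by (simp flip: sum.inter_restrict add: sum.If_cases)
    then show ?thesis
      using E zero_centrally_minimal family_CP[OF CP_zero] by (auto simp: splits_def)
  qed
  moreover have "D \<in> CP" "D \<noteq> 0"
    using sys by (auto simp: full_system_def)
  ultimately show ?thesis
    using CD by blast
qed

text \<open>
  The properties required of the patched operators \<open>Y i\<close> come down to identities in \<open>M\<close>, checked after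
  multiplication by each \<open>C \<in> \<C>\<close>, where \<open>Y i\<close> becomes \<open>E C i\<close>.
\<close>

lemma bounded_imp_decomposition:
  assumes bound: "\<And>k D E. full_system k D E \<Longrightarrow> k \<le> n" and bdd: "bounded \<P>"
  shows "has_finite_SI_decomposition M T"
proof -
  obtain \<C> where "\<C> \<subseteq> {D \<in> CP. \<exists>E. splits n D E}"
    and \<C>_orth: "\<And>C D. C \<in> \<C> \<Longrightarrow> D \<in> \<C> \<Longrightarrow> C \<noteq> D \<Longrightarrow> C o\<^sub>L D = 0"
    and eqI: "\<And>F H. F \<in> M \<Longrightarrow> H \<in> M \<Longrightarrow> (\<And>C. C \<in> \<C> \<Longrightarrow> C o\<^sub>L F = C o\<^sub>L H) \<Longrightarrow> F = H"
  proof (rule central_exhaustion[of "\<lambda>D. \<exists>E. splits n D E", OF splits_below[OF bound]], goal_cases)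
    case (4 \<C>)
    show ?case
      using 4(2-) by (rule 4(1))
  qed
  then have CP: "\<And>C. C \<in> \<C> \<Longrightarrow> C \<in> CP" and "\<forall>C\<in>\<C>. \<exists>E. splits n C E"
    by auto
  then obtain E where E: "\<And>C. C \<in> \<C> \<Longrightarrow> splits n C (E C)"
    by metis
  have EP: "E C i \<in> \<P>" and Emin: "centrally_minimal M T (E C i)" if "C \<in> \<C>" "i < n" for C i
    using E[OF that(1)] that(2) by (auto simp: splits_def)
  have Eo: "E C i o\<^sub>L E C j = 0" if "C \<in> \<C>" "i < n" "j < n" "i \<noteq> j" for C i j
    using E[OF that(1)] that(2-) by (auto simp: splits_def)
  have Esum: "(\<Sum>i<n. E C i) = C" if "C \<in> \<C>" for C
    using E[OF that(1)] by (auto simp: splits_def)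
  have EE: "E C i o\<^sub>L E C i = E C i" if "C \<in> \<C>" "i < n" for C i
    using family_Idem[OF EP[OF that]] by (simp add: Idem_iff)
  have EM: "E C i \<in> M" if "C \<in> \<C>" "i < n" for C i
    by (rule family_M[OF EP[OF that]])
  have EC: "E C i o\<^sub>L C = E C i" if "C \<in> \<C>" "i < n" for C i
  proof -
    have "E C i o\<^sub>L C = E C i o\<^sub>L (\<Sum>j<n. E C j)"
      by (simp add: Esum that)
    also have "\<dots> = (\<Sum>j<n. if j = i then E C i else 0)"
      unfolding compose_simps using that Eo EE by (intro sum.cong) auto
    finally show ?thesis
      using that by simp
  qed
  obtain b where b: "\<And>P. P \<in> \<P> \<Longrightarrow> norm P \<le> b"
    using bdd by (auto simp: bounded_iff)
  have "\<exists>Y\<in>M. \<forall>C\<in>\<C>. Y o\<^sub>L C = E C i o\<^sub>L C" if "i < n" for i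
    using that by (intro central_patching[where b = b]) (auto simp: CP EM b EP \<C>_orth)
  then obtain Y where YM: "\<And>i. i < n \<Longrightarrow> Y i \<in> M"
    and "\<And>i C. i < n \<Longrightarrow> C \<in> \<C> \<Longrightarrow> Y i o\<^sub>L C = E C i o\<^sub>L C"
    by metis
  then have YC: "Y i o\<^sub>L C = E C i" if "i < n" "C \<in> \<C>" for i C
    using that EC by simp
  have CY: "C o\<^sub>L Y i = E C i" if "i < n" "C \<in> \<C>" for i C
    using YC[OF that] CP_commute[OF CP[OF that(2)] YM[OF that(1)]] by simp
  have CYY: "C o\<^sub>L (Y i o\<^sub>L Y j) = E C i o\<^sub>L E C j" if "i < n" "j < n" "C \<in> \<C>" for i j C
  proof -
    have "C o\<^sub>L (Y i o\<^sub>L Y j) = (C o\<^sub>L C) o\<^sub>L (Y i o\<^sub>L Y j)"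
      using CP_D(3)[OF CP[OF that(3)]] by simp
    also have "\<dots> = (C o\<^sub>L Y i) o\<^sub>L (C o\<^sub>L Y j)"
      using CP_commute[OF CP[OF that(3)] YM[OF that(1)]] by (metis compose_assoc)
    finally show ?thesis
      using that by (simp add: CY)
  qed
  have YI: "Y i \<in> Idem" if i: "i < n" for i
  proof -
    have "Y i o\<^sub>L Y i = Y i"
      by (rule eqI) (simp_all add: i YM compose_mem CYY CY EE)
    moreover have "Y i o\<^sub>L T = T o\<^sub>L Y i"
    proof (rule eqI)
      fix C assume C: "C \<in> \<C>"
      have "C o\<^sub>L (Y i o\<^sub>L T) = E C i o\<^sub>L T"
        using CY[OF i C] by (simp add: compose_assoc[symmetric])
      also have "\<dots> = T o\<^sub>L E C i"
        using family_Idem[OF EP[OF C i]] by (simp add: Idem_iff)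
      also have "\<dots> = T o\<^sub>L (C o\<^sub>L Y i)"
        by (simp add: CY[OF i C])
      also have "\<dots> = C o\<^sub>L (T o\<^sub>L Y i)"
        using CP_commute[OF CP[OF C] T] by (metis compose_assoc)
      finally show "C o\<^sub>L (Y i o\<^sub>L T) = C o\<^sub>L (T o\<^sub>L Y i)" .
    qed (use YM[OF i] T compose_mem in auto)
    ultimately show ?thesis
      using YM[OF i] by (simp add: Idem_iff)
  qed
  have Yo: "Y i o\<^sub>L Y j = 0" if "i < n" "j < n" "i \<noteq> j" for i j
    by (rule eqI) (simp_all add: that YM compose_mem zero_mem CYY Eo)
  have Ysum: "(\<Sum>i<n. Y i) = id_blinfun"
  proof (rule eqI)
    show "(\<Sum>i<n. Y i) \<in> M"
      using YM by (intro sum_mem) auto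
  qed (simp_all add: id_mem compose_simps CY Esum)
  have Ymin: "centrally_minimal M T (Y i)" if i: "i < n" for i
  proof -
    have "Q = Y i o\<^sub>L cs Q" if Q: "Q \<in> Idem" "Q \<preceq> Y i" for Q
    proof (rule eqI)
      fix C assume C: "C \<in> \<C>"
      note CPC = CP[OF C]
      have CQ: "C o\<^sub>L Q = Q o\<^sub>L C"
        by (rule CP_commute[OF CPC Idem_M[OF Q(1)]])
      have YQ: "Y i o\<^sub>L Q = Q" "Q o\<^sub>L Y i = Q"
        using Q(2) by (auto simp: idem_le_iff)
      have "E C i o\<^sub>L (C o\<^sub>L Q) = C o\<^sub>L Q"
      proof -
        have "E C i o\<^sub>L (C o\<^sub>L Q) = (E C i o\<^sub>L C) o\<^sub>L Q"
          by (simp add: compose_assoc)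
        also have "\<dots> = (C o\<^sub>L Y i) o\<^sub>L Q"
          by (simp add: CY EC C i)
        finally show ?thesis
          by (simp add: compose_assoc YQ)
      qed
      moreover have "(C o\<^sub>L Q) o\<^sub>L E C i = C o\<^sub>L Q"
      proof -
        have "(C o\<^sub>L Q) o\<^sub>L E C i = C o\<^sub>L ((Q o\<^sub>L Y i) o\<^sub>L C)"
          by (simp add: YC[OF i C, symmetric] compose_assoc)
        also have "\<dots> = (C o\<^sub>L C) o\<^sub>L Q"
          by (simp add: YQ CQ[symmetric] compose_assoc)
        finally show ?thesis
          by (simp add: CP_D(3)[OF CPC])
      qed
      ultimately have "C o\<^sub>L Q \<preceq> E C i"
        by (simp add: idem_le_iff)
      moreover have "C o\<^sub>L Q \<in> Idem"
        by (rule Idem_compose[OF CP_Idem[OF CPC] Q(1) CQ])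
      ultimately have "C o\<^sub>L Q = E C i o\<^sub>L cs (C o\<^sub>L Q)"
        using Emin[OF C i] by (auto simp: centrally_minimal_def)
      also have "\<dots> = (E C i o\<^sub>L C) o\<^sub>L cs Q"
        by (simp add: cs_cut[OF CPC] compose_assoc)
      also have "\<dots> = (C o\<^sub>L Y i) o\<^sub>L cs Q"
        by (simp only: EC[OF C i] CY[OF i C])
      also have "\<dots> = C o\<^sub>L (Y i o\<^sub>L cs Q)"
        by (rule compose_assoc)
      finally show "C o\<^sub>L Q = C o\<^sub>L (Y i o\<^sub>L cs Q)" .
    qed (simp_all add: Idem_M[OF Q(1)] YM[OF i] CP_D(1)[OF cs_CP] compose_mem)
    then show ?thesis
      using YI[OF i] by (simp add: centrally_minimal_def)
  qed
  \<comment> \<open>A strongly irreducible decomposition has nonzero members, so the vanishing \<open>Y i\<close> are dropped.\<close>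
  define I where "I = {i. i < n \<and> Y i \<noteq> 0}"
  have "finite I"
    by (simp add: I_def)
  then obtain h where h: "bij_betw h {1..card I} I"
    using ex_bij_betw_nat_finite_1 by blast
  have hI: "h j < n" "Y (h j) \<noteq> 0" if "j \<in> {1..card I}" for j
    using bij_betwE[OF h] that by (auto simp: I_def)
  have hinj: "h j \<noteq> h k" if "j \<in> {1..card I}" "k \<in> {1..card I}" "j \<noteq> k" for j k
    by (rule inj_on_contraD[OF bij_betw_imp_inj_on[OF h] that(3,1,2)])
  have "(\<Sum>j=1..card I. Y (h j)) = (\<Sum>i\<in>I. Y i)"
    by (rule sum.reindex_bij_betw[OF h])
  also have "\<dots> = (\<Sum>i<n. Y i)"
    by (rule sum.mono_neutral_left) (auto simp: I_def)
  finally have "(\<Sum>j=1..card I. Y (h j)) = id_blinfun"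
    by (simp add: Ysum)
  then show ?thesis
    unfolding has_finite_SI_decomposition_def
  proof (intro exI conjI ballI impI)
    show "Y (h j) \<in> Idem" "Y (h j) \<noteq> 0" "centrally_minimal M T (Y (h j))"
      if "j \<in> {1..card I}" for j
      using hI[OF that] YI Ymin by auto
    show "Y (h j) o\<^sub>L Y (h k) = 0"
      if "j \<in> {1..card I}" "k \<in> {1..card I}" "j \<noteq> k" for j k
      using hI(1) hinj that Yo by blast
  qed
qed

end

theorem theorem3p17:
  fixes n :: nat
    and M :: "('h::complex_hilbert_space \<Rightarrow>\<^sub>L 'h) set"
    and A :: "('k::complex_hilbert_space \<Rightarrow>\<^sub>L 'k) set"
    and T :: "'h \<Rightarrow>\<^sub>L 'h"
  assumes "n \<ge> 1"
    and "type_I_via n A M"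
    and "T \<in> M"
  shows "property_J M T \<longleftrightarrow> has_finite_SI_decomposition M T"
proof -
  interpret vn_operator M T
    using assms(2,3) by unfold_locales (simp_all add: type_I_via_def)
  show ?thesis
  proof
    assume "property_J M T"
    then obtain \<P> where \<P>: "abelian_idempotent_family M T \<P>" "bounded \<P>"
      and max: "\<And>\<Q>. abelian_idempotent_family M T \<Q> \<Longrightarrow> \<P> \<subseteq> \<Q> \<Longrightarrow> \<Q> = \<P>"
      unfolding property_J_def by blast
    interpret maximal_family M T \<P>
      using \<P>(1) max by unfold_locales
    have "k \<le> n" if sys: "full_system k D E" for k D E
    proof (rule ccontr)
      assume "\<not> k \<le> n"
      then have le: "i < k" if "i \<le> n" for i
        using that by simp
      show False
      proof (rule type_I_finiteness[OF assms(2)])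
        show "D \<in> CP" "D \<noteq> 0"
          using sys by (auto simp: full_system_def)
        show "E i \<in> M" "full_on (E i) D" if "i \<le> n" for i
          using sys le[OF that] family_M by (auto simp: full_system_def)
        show "E i o\<^sub>L E i = E i" if "i \<le> n" for i
          using sys le[OF that] family_Idem by (auto simp: full_system_def Idem_iff)
        show "E i o\<^sub>L E j = 0" if "i \<le> n" "j \<le> n" "i \<noteq> j" for i j
          using sys le that by (auto simp: full_system_def)
      qed
    qed
    then show "has_finite_SI_decomposition M T"
      by (rule bounded_imp_decomposition[OF _ \<P>(2)])
  next
    assume "has_finite_SI_decomposition M T"
    then show "property_J M T"
      by (rule decomposition_imp_property_J)
  qed
qed

end
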